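(* Fix rational numbers $\beta,\gamma$ with $(\beta,\gamma)\in\Gamma$. There is an algorithm running in time polynomial in the bit-length of its input that, given rational numbers $R>0$ and $\varepsilon>0$, outputs a graph $G$ and a vertex $v\in V(G)$ such that $[Z_{G,v}]_0\neq 0$ and $\frac{[Z_{G,v}]_1}{[Z_{G,v}]_0}\in(e^{-\varepsilon}R,e^{\varepsilon}R)$.
   Context: $\Gamma=\{(\beta,\gamma)\in\mathbb{R}^2:\beta>\gamma,\ -2<\beta+\gamma<1,\ \gamma<0\}\setminus\{(1,-1)\}$. Graphs are finite undirected multigraphs, possibly with self-loops and parallel edges. Let $A=\begin{bmatrix}\beta&1\\1&\gamma\end{bmatrix}$. For a graph $G=(V,E)$ and $v\in V$, $[Z_{G,v}]_i=\sum_{\sigma\in\{0,1\}^V,\ \sigma(v)=i}\prod_{\{x,y\}\in E}A_{\sigma(x),\sigma(y)}$ for $i\in\{0,1\}$. *)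

theory Defs
  imports
    "HOL-Analysis.Analysis"
    "HOL-Computational_Algebra.Polynomial"
    "HOL-Library.Multiset"
    "HOL-Library.Uprod"
    "HOL-Library.Log_Nat"
begin

text \<open>Edges are unordered pairs; the self-loop at \<open>x\<close> is \<open>Upair x x\<close>, and
  parallel edges are counted by the multiset.\<close>

record 'v multigraph =
  verts :: "'v set"
  edges :: "'v uprod multiset"

definition wf_multigraph :: "'v multigraph \<Rightarrow> bool" where
  "wf_multigraph G \<longleftrightarrow> finite (verts G) \<and> (\<forall>e \<in># edges G. set_uprod e \<subseteq> verts G)"

definition param_region :: "(real \<times> real) set" where
  "param_region =
     {(\<beta>, \<gamma>). \<beta> > \<gamma> \<and> -2 < \<beta> + \<gamma> \<and> \<beta> + \<gamma> < 1 \<and> \<gamma> < 0} - {(1, -1)}"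

definition A_entry :: "real \<Rightarrow> real \<Rightarrow> nat \<Rightarrow> nat \<Rightarrow> real" where
  "A_entry \<beta> \<gamma> i j = (if i = 0 \<and> j = 0 then \<beta> else if i = 1 \<and> j = 1 then \<gamma> else 1)"

lift_definition edge_weight :: "real \<Rightarrow> real \<Rightarrow> ('v \<Rightarrow> nat) \<Rightarrow> 'v uprod \<Rightarrow> real"
  is "\<lambda>\<beta> \<gamma> \<sigma> (x, y). A_entry \<beta> \<gamma> (\<sigma> x) (\<sigma> y)"
  by (auto simp: A_entry_def)

lemma edge_weight_Upair [simp]:
  "edge_weight \<beta> \<gamma> \<sigma> (Upair x y) = A_entry \<beta> \<gamma> (\<sigma> x) (\<sigma> y)"
  by transfer simp

definition Z :: "real \<Rightarrow> real \<Rightarrow> 'v multigraph \<Rightarrow> 'v \<Rightarrow> nat \<Rightarrow> real" where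
  "Z \<beta> \<gamma> G v i =
     (\<Sum>\<sigma> \<in> {\<sigma> \<in> verts G \<rightarrow>\<^sub>E {0, 1}. \<sigma> v = i}. \<Prod>e \<in># edges G. edge_weight \<beta> \<gamma> \<sigma> e)"

text \<open>Algorithms are programs over finitely many integer registers with a write-only
  output tape. Time is counted in bit operations: a register access, addition or
  subtraction costs the bit-lengths of its operands, a multiplication or division the
  product of these (the schoolbook cost). This is a register machine under the
  logarithmic cost criterion. It is polynomially equivalent to multitape Turing machines:
  a Turing machine carries out every operation in time polynomial in its cost, with one
  tape per register, and conversely the two halves of a tape are binary numbers, on which
  a head move is a doubling or a halving.\<close>

text \<open>Binary digits of the absolute value and a sign bit.\<close>

definition bits :: "int \<Rightarrow> nat" where
  "bits n = nat (bitlen \<bar>n\<bar>) + 1"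

datatype aexp =
    Const int
  | Reg nat
  | Add aexp aexp
  | Sub aexp aexp
  | Mul aexp aexp
  | Div aexp aexp

fun aval :: "aexp \<Rightarrow> (nat \<Rightarrow> int) \<Rightarrow> int" where
  "aval (Const n) s = n"
| "aval (Reg r) s = s r"
| "aval (Add a b) s = aval a s + aval b s"
| "aval (Sub a b) s = aval a s - aval b s"
| "aval (Mul a b) s = aval a s * aval b s"
| "aval (Div a b) s = aval a s div aval b s"

fun acost :: "aexp \<Rightarrow> (nat \<Rightarrow> int) \<Rightarrow> nat" where
  "acost (Const n) s = bits n"
| "acost (Reg r) s = bits (s r)"
| "acost (Add a b) s = acost a s + acost b s + bits (aval a s) + bits (aval b s)"
| "acost (Sub a b) s = acost a s + acost b s + bits (aval a s) + bits (aval b s)"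
| "acost (Mul a b) s = acost a s + acost b s + bits (aval a s) * bits (aval b s)"
| "acost (Div a b) s = acost a s + acost b s + bits (aval a s) * bits (aval b s)"

datatype com =
    Skip
  | Assign nat aexp
  | Emit aexp
  | Seq com com
  | Cond aexp com com
  | While aexp com

type_synonym config = "(nat \<Rightarrow> int) \<times> int list"

text \<open>\<open>exec c s t s'\<close>: started in \<open>s\<close>, the program \<open>c\<close> halts in \<open>s'\<close> after time \<open>t\<close>.
  A test succeeds if the value of its expression is positive.\<close>

inductive exec :: "com \<Rightarrow> config \<Rightarrow> nat \<Rightarrow> config \<Rightarrow> bool" where
  Skip: "exec Skip s 1 s"
| Assign: "exec (Assign r a) (s, out) (acost a s + 1) (s(r := aval a s), out)"
| Emit: "exec (Emit a) (s, out) (acost a s + 1) (s, out @ [aval a s])"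
| Seq: "exec c1 s t1 s' \<Longrightarrow> exec c2 s' t2 s'' \<Longrightarrow> exec (Seq c1 c2) s (t1 + t2) s''"
| Cond_true: "aval b s > 0 \<Longrightarrow> exec c1 (s, out) t s' \<Longrightarrow>
    exec (Cond b c1 c2) (s, out) (acost b s + 1 + t) s'"
| Cond_false: "\<not> aval b s > 0 \<Longrightarrow> exec c2 (s, out) t s' \<Longrightarrow>
    exec (Cond b c1 c2) (s, out) (acost b s + 1 + t) s'"
| While_false: "\<not> aval b s > 0 \<Longrightarrow> exec (While b c) (s, out) (acost b s + 1) (s, out)"
| While_true: "aval b s > 0 \<Longrightarrow> exec c (s, out) t1 s' \<Longrightarrow> exec (While b c) s' t2 s'' \<Longrightarrow>
    exec (While b c) (s, out) (acost b s + 1 + t1 + t2) s''"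

lemma exec_deterministic:
  "exec c s t s' \<Longrightarrow> exec c s u s'' \<Longrightarrow> u = t \<and> s'' = s'"
proof (induction arbitrary: u s'' rule: exec.induct)
  case Skip
  then show ?case by (auto elim: exec.cases)
next
  case Assign
  then show ?case by (auto elim: exec.cases)
next
  case Emit
  then show ?case by (auto elim: exec.cases)
next
  case (Seq c1 s t1 s' c2 t2 s3)
  from Seq.prems show ?case by cases (use Seq.IH in blast)
next
  case Cond_true
  from Cond_true.prems show ?case by cases (use Cond_true in blast)+
next
  case Cond_false
  from Cond_false.prems show ?case by cases (use Cond_false in blast)+
next
  case While_false
  from While_false.prems show ?case by cases (use While_false in auto)
next
  case While_true
  from While_true.prems show ?case by cases (use While_true in blast)+
qed

definition init_regs :: "int list \<Rightarrow> nat \<Rightarrow> int" where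
  "init_regs xs r = (if r < length xs then xs ! r else 0)"

definition computes_in_time :: "com \<Rightarrow> int list \<Rightarrow> nat \<Rightarrow> int list \<Rightarrow> bool" where
  "computes_in_time c xs t out \<longleftrightarrow> (\<exists>s. exec c (init_regs xs, []) t (s, out))"

definition bit_length :: "int list \<Rightarrow> nat" where
  "bit_length xs = sum_list (map bits xs)"

definition encode_rat :: "rat \<Rightarrow> int list" where
  "encode_rat q = [fst (quotient_of q), snd (quotient_of q)]"

text \<open>A graph is written as the number of its vertices, the list of vertices, the
  distinguished vertex, and the list of edges, in which every parallel edge is listed
  separately. Vertices and edges are listed explicitly so that writing the graph takes
  time at least its number of vertices and edges.\<close>

definition encodes_graph :: "int list \<Rightarrow> nat multigraph \<Rightarrow> nat \<Rightarrow> bool" where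
  "encodes_graph out G v \<longleftrightarrow>
     (\<exists>vs es. distinct vs \<and> set vs = verts G
        \<and> mset (map (\<lambda>(x, y). Upair x y) es) = edges G
        \<and> out = int (length vs) # map int vs @ int v # concat (map (\<lambda>(x, y). [int x, int y]) es))"

end

theory Submission
  imports Defs
begin

text \<open>
  Write \<open>r = Z\<^sub>1 / Z\<^sub>0\<close> for the ratio of a rooted graph. Identifying roots multiplies ratios, and
  hanging the root on a new root by an edge applies \<open>f(r) = (1 + \<gamma> r) / (\<beta> + r)\<close>.

  In the parameter region some ratio \<open>y\<close> with \<open>|y| > 1\<close> is realized by a short path, possibly with
  loops at its end. Then \<open>f(y\<^sup>2\<^sup>n)\<close> tends to \<open>\<gamma> < 0\<close> through distinct values, so the logarithms
  of the realized \<open>|r|\<close> form an additive semigroup with positive and negative elements and with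
  distinct elements arbitrarily close together; such a semigroup is dense in the reals, and
  realized ratios of both signs are dense.

  For large \<open>r\<close>, \<open>f\<close> contracts the logarithmic distance. By density and compactness finitely many
  negative realized \<open>a\<close> suffice for the sets \<open>a f(I)\<close> to cover a window \<open>I\<close>. Pulling the target back
  through these maps for \<open>n\<close> steps and starting from any realized ratio in \<open>I\<close> leaves an error
  \<open>O(2\<^sup>-\<^sup>n)\<close>; the target is first moved into \<open>I\<close> by multiplications with fixed ratios. The pull-backs
  are fixed integer matrices, so the numbers grow by \<open>O(1)\<close> bits per step.
\<close>

section \<open>Partition functions of rooted graphs\<close>

text \<open>Density alone does not bound the size of a graph with a prescribed ratio. It only
  supplies, for fixed \<beta> and \<gamma>, finitely many gadgets that are hard-wired into the
  program; how they are found costs no running time. All dependence on the input comes from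
  iterating them, and geometric contraction makes linearly many iterations in the bit-length
  suffice. The multipliers \<open>a\<close> are negative because \<open>edge_map\<close> is negative
  for large arguments while the targets are positive. Rationality of \<beta> and \<gamma> makes all
  realized ratios rational, hence the pull-backs exact over the integers; fractions are not reduced
  and the sign of the denominator is not controlled, which dictates the form of the tests. As for
  the region: -2 < \<beta> + \<gamma> is behind \<beta> \<gamma> < 1, which makes
  \<open>edge_map\<close> decreasing to the right of its pole, and behind a ratio of absolute value
  below 1; \<beta> + \<gamma> < 1 and the removal of (1, -1) are behind a ratio of absolute value
  above 1.\<close>

definition mgraph :: "'v set \<Rightarrow> ('v \<times> 'v) list \<Rightarrow> 'v multigraph" where
  "mgraph V E = \<lparr>verts = V, edges = mset (map (\<lambda>(x, y). Upair x y) E)\<rparr>"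

definition edges_in :: "'v set \<Rightarrow> ('v \<times> 'v) list \<Rightarrow> bool" where
  "edges_in V E \<longleftrightarrow> set E \<subseteq> V \<times> V"

lemma edges_in_simps [simp]:
  "edges_in V []"
  "edges_in V ((x, y) # E) \<longleftrightarrow> x \<in> V \<and> y \<in> V \<and> edges_in V E"
  "edges_in V (E @ E') \<longleftrightarrow> edges_in V E \<and> edges_in V E'"
  by (auto simp: edges_in_def)

lemma edges_in_mono: "edges_in V E \<Longrightarrow> V \<subseteq> W \<Longrightarrow> edges_in W E"
  by (auto simp: edges_in_def)

lemma wf_mgraph: "finite V \<Longrightarrow> edges_in V E \<Longrightarrow> wf_multigraph (mgraph V E)"
  by (fastforce simp: wf_multigraph_def mgraph_def edges_in_def)

locale two_spin =
  fixes \<beta> \<gamma> :: real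
begin

text \<open>Edges are a list of ordered pairs, the form in which the program writes them and which
  admits list induction. Orientation is harmless because \<open>A_entry\<close> is
  symmetric.\<close>

definition wt :: "('v \<times> 'v) list \<Rightarrow> ('v \<Rightarrow> nat) \<Rightarrow> real" where
  "wt E \<sigma> = (\<Prod>(x, y)\<leftarrow>E. A_entry \<beta> \<gamma> (\<sigma> x) (\<sigma> y))"

lemma wt_simps [simp]:
  "wt [] \<sigma> = 1"
  "wt ((x, y) # E) \<sigma> = A_entry \<beta> \<gamma> (\<sigma> x) (\<sigma> y) * wt E \<sigma>"
  "wt (E @ E') \<sigma> = wt E \<sigma> * wt E' \<sigma>"
  by (auto simp: wt_def)

lemma wt_cong: "edges_in V E \<Longrightarrow> (\<And>x. x \<in> V \<Longrightarrow> \<sigma> x = \<tau> x) \<Longrightarrow> wt E \<sigma> = wt E \<tau>"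
  by (induction E) auto

lemma wt_map: "wt (map (map_prod h h) E) \<sigma> = wt E (\<sigma> \<circ> h)"
  by (induction E) auto

lemma prod_edge_weight: "(\<Prod>e\<in>#edges (mgraph V E). edge_weight \<beta> \<gamma> \<sigma> e) = wt E \<sigma>"
  by (induction E) (auto simp: mgraph_def)

text \<open>Once the root spin is fixed, only the spins on \<open>U\<close> are summed, over the
  same index set for both values of \<open>i\<close>. Gadget computations are done in this
  form.\<close>

lemma Z_mgraph_insert:
  assumes "r \<notin> U" "i \<in> {0, 1}"
  shows "Z \<beta> \<gamma> (mgraph (insert r U) E) r i = (\<Sum>\<tau>\<in>U \<rightarrow>\<^sub>E {0, 1}. wt E (\<tau>(r := i)))"
  unfolding Z_def prod_edge_weight
  by (rule sum.reindex_bij_witness[where i = "\<lambda>\<tau>. \<tau>(r := i)" and j = "\<lambda>\<sigma>. \<sigma>(r := undefined)"])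
    (use assms in \<open>auto simp: mgraph_def PiE_iff extensional_def fun_upd_idem_iff fun_upd_idem split: if_splits\<close>)

text \<open>The pair is recorded instead of the ratio because \<open>z0\<close> may vanish on the
  way: for \<beta> = 0 a loop gives the pair (0, \<gamma>), which is still a useful building
  block.\<close>

definition rooted :: "'v set \<Rightarrow> ('v \<times> 'v) list \<Rightarrow> 'v \<Rightarrow> real \<Rightarrow> real \<Rightarrow> bool" where
  "rooted V E r z0 z1 \<longleftrightarrow> finite V \<and> r \<in> V \<and> edges_in V E \<and>
     Z \<beta> \<gamma> (mgraph V E) r 0 = z0 \<and> Z \<beta> \<gamma> (mgraph V E) r 1 = z1"

lemma rooted_insert_iff:
  assumes "r \<notin> U"
  shows "rooted (insert r U) E r z0 z1 \<longleftrightarrow> finite U \<and> edges_in (insert r U) E \<and>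
     (\<Sum>\<tau>\<in>U \<rightarrow>\<^sub>E {0, 1}. wt E (\<tau>(r := 0))) = z0 \<and>
     (\<Sum>\<tau>\<in>U \<rightarrow>\<^sub>E {0, 1}. wt E (\<tau>(r := 1))) = z1"
  using assms by (simp add: rooted_def Z_mgraph_insert)

lemma rooted_remove:
  assumes "rooted V E r z0 z1"
  obtains U where "V = insert r U" "r \<notin> U" "finite U"
  using assms unfolding rooted_def by (metis finite_Diff mk_disjoint_insert finite_insert)

lemma rooted_single: "rooted {r} [] r 1 1"
  by (subst rooted_insert_iff) auto

lemma rooted_loop: "rooted {r} [(r, r)] r \<beta> \<gamma>"
  by (subst rooted_insert_iff) (auto simp: A_entry_def)

text \<open>A configuration on a disjoint union is a pair of configurations, and each factor sees
  only its own half.\<close>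

lemma sum_PiE_Un_mult:
  fixes F G :: "('v \<Rightarrow> 'b) \<Rightarrow> 'c :: comm_semiring_0"
  assumes "U \<inter> W = {}"
    and "\<And>\<sigma> \<tau>. (\<And>x. x \<in> U \<Longrightarrow> \<sigma> x = \<tau> x) \<Longrightarrow> F \<sigma> = F \<tau>"
    and "\<And>\<sigma> \<tau>. (\<And>x. x \<in> W \<Longrightarrow> \<sigma> x = \<tau> x) \<Longrightarrow> G \<sigma> = G \<tau>"
  shows "(\<Sum>\<tau>\<in>(U \<union> W) \<rightarrow>\<^sub>E S. F \<tau> * G \<tau>) = (\<Sum>\<tau>\<in>U \<rightarrow>\<^sub>E S. F \<tau>) * (\<Sum>\<tau>\<in>W \<rightarrow>\<^sub>E S. G \<tau>)"
proof -
  have F: "F (restrict \<tau> U) = F \<tau>" and G: "G (restrict \<tau> W) = G \<tau>" for \<tau>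
    by (rule assms(2), simp) (rule assms(3), simp)
  have "(\<Sum>\<tau>\<in>(U \<union> W) \<rightarrow>\<^sub>E S. F \<tau> * G \<tau>) = (\<Sum>(\<sigma>, \<tau>)\<in>(U \<rightarrow>\<^sub>E S) \<times> (W \<rightarrow>\<^sub>E S). F \<sigma> * G \<tau>)"
    by (rule sum.reindex_bij_witness[where i = "\<lambda>(\<sigma>, \<tau>) x. if x \<in> U then \<sigma> x else \<tau> x"
          and j = "\<lambda>\<tau>. (restrict \<tau> U, restrict \<tau> W)"])
      (use assms(1) in \<open>auto simp: F G PiE_iff extensional_def fun_eq_iff split: if_splits\<close>)
  then show ?thesis
    by (simp add: sum_product sum.cartesian_product)
qed

lemma rooted_merge:
  assumes "rooted V E r z0 z1" "rooted V' E' r w0 w1" "V \<inter> V' = {r}"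
  shows "rooted (V \<union> V') (E @ E') r (z0 * w0) (z1 * w1)"
proof -
  obtain U U' where U: "V = insert r U" "r \<notin> U" and U': "V' = insert r U'" "r \<notin> U'"
    using assms(1,2) rooted_remove by metis
  have disj: "U \<inter> U' = {}"
    using assms(3) U U' by auto
  have VV: "V \<union> V' = insert r (U \<union> U')" "r \<notin> U \<union> U'"
    using U U' by auto
  have E: "edges_in (insert r U) E" "edges_in (insert r U') E'"
    using assms U U' by (auto simp: rooted_def)
  have "(\<Sum>\<tau>\<in>(U \<union> U') \<rightarrow>\<^sub>E {0, 1}. wt E (\<tau>(r := i)) * wt E' (\<tau>(r := i))) =
      (\<Sum>\<tau>\<in>U \<rightarrow>\<^sub>E {0, 1}. wt E (\<tau>(r := i))) * (\<Sum>\<tau>\<in>U' \<rightarrow>\<^sub>E {0, 1}. wt E' (\<tau>(r := i)))" for i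
    by (rule sum_PiE_Un_mult[OF disj]; rule wt_cong, rule E, auto)
  then show ?thesis
    using assms(1,2) edges_in_mono[OF E(1), of "insert r (U \<union> U')"]
      edges_in_mono[OF E(2), of "insert r (U \<union> U')"] VV(2) unfolding VV(1)
    by (auto simp: rooted_insert_iff U U')
qed

text \<open>The new root sees the old graph only through the spin of the old root, so the pair is
  multiplied by the matrix \<open>A\<close>.\<close>

lemma rooted_extend:
  assumes "rooted V E r z0 z1" "r' \<notin> V"
  shows "rooted (insert r' V) ((r', r) # E) r' (\<beta> * z0 + z1) (z0 + \<gamma> * z1)"
proof -
  have V: "finite V" "r \<in> V" "edges_in V E"
    using assms(1) by (auto simp: rooted_def)
  have Zr: "Z \<beta> \<gamma> (mgraph V E) r j = (\<Sum>\<tau>\<in>{\<tau> \<in> V \<rightarrow>\<^sub>E {0, 1}. \<tau> r = j}. wt E \<tau>)" for j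
    by (simp add: Z_def prod_edge_weight) (simp add: mgraph_def)
  have "(\<Sum>\<tau>\<in>V \<rightarrow>\<^sub>E {0, 1}. wt ((r', r) # E) (\<tau>(r' := i))) =
      A_entry \<beta> \<gamma> i 0 * z0 + A_entry \<beta> \<gamma> i 1 * z1" for i
  proof -
    have split: "V \<rightarrow>\<^sub>E {0, 1} = {\<tau> \<in> V \<rightarrow>\<^sub>E {0, 1}. \<tau> r = 0} \<union> {\<tau> \<in> V \<rightarrow>\<^sub>E {0, 1::nat}. \<tau> r = 1}"
      using V(2) by blast
    have fin: "finite (V \<rightarrow>\<^sub>E {0, 1::nat})"
      using V(1) by (simp add: finite_PiE)
    have w: "wt ((r', r) # E) (\<tau>(r' := i)) = A_entry \<beta> \<gamma> i (\<tau> r) * wt E \<tau>" for \<tau>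
    proof -
      have "wt E (\<tau>(r' := i)) = wt E \<tau>"
        by (rule wt_cong[OF V(3)]) (use assms(2) in auto)
      then show ?thesis
        using assms(2) V(2) by auto
    qed
    have "(\<Sum>\<tau>\<in>V \<rightarrow>\<^sub>E {0, 1}. A_entry \<beta> \<gamma> i (\<tau> r) * wt E \<tau>) =
      (\<Sum>\<tau>\<in>{\<tau> \<in> V \<rightarrow>\<^sub>E {0, 1}. \<tau> r = 0}. A_entry \<beta> \<gamma> i (\<tau> r) * wt E \<tau>) +
      (\<Sum>\<tau>\<in>{\<tau> \<in> V \<rightarrow>\<^sub>E {0, 1}. \<tau> r = 1}. A_entry \<beta> \<gamma> i (\<tau> r) * wt E \<tau>)"
      by (subst split, rule sum.union_disjoint) (use fin in auto)
    also have "\<dots> = A_entry \<beta> \<gamma> i 0 * z0 + A_entry \<beta> \<gamma> i 1 * z1"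
      using assms(1) by (auto simp: rooted_def Zr sum_distrib_left)
    finally show ?thesis
      by (simp only: w)
  qed
  then show ?thesis
    using assms(2) V edges_in_mono[OF V(3), of "insert r' V"]
    by (subst rooted_insert_iff) (auto simp: A_entry_def simp del: wt_simps)
qed

lemma rooted_rename:
  assumes "rooted V E r z0 z1" "inj_on h V"
  shows "rooted (h ` V) (map (map_prod h h) E) (h r) z0 z1"
proof -
  obtain U where U: "V = insert r U" "r \<notin> U"
    using assms(1) rooted_remove by metis
  have hr: "h r \<notin> h ` U" and inj: "inj_on h U" and hV: "h ` V = insert (h r) (h ` U)"
    using assms(2) U by (auto simp: inj_on_def)
  have E: "edges_in (insert r U) E"
    using assms U by (auto simp: rooted_def)
  have bij: "(\<Sum>\<tau>\<in>h ` U \<rightarrow>\<^sub>E {0, 1}. wt (map (map_prod h h) E) (\<tau>(h r := i))) =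
      (\<Sum>\<tau>\<in>U \<rightarrow>\<^sub>E {0, 1}. wt E (\<tau>(r := i)))" for i
  proof (rule sum.reindex_bij_witness[where i = "\<lambda>\<tau>. restrict (\<tau> \<circ> the_inv_into U h) (h ` U)"
          and j = "\<lambda>\<tau>. restrict (\<tau> \<circ> h) U"])
    fix \<tau> :: "_ \<Rightarrow> nat"
    assume \<tau>: "\<tau> \<in> h ` U \<rightarrow>\<^sub>E {0, 1}"
    show "restrict (restrict (\<tau> \<circ> h) U \<circ> the_inv_into U h) (h ` U) = \<tau>"
    proof
      fix x
      show "restrict (restrict (\<tau> \<circ> h) U \<circ> the_inv_into U h) (h ` U) x = \<tau> x"
        using \<tau> inj by (cases "x \<in> h ` U") (auto simp: the_inv_into_f_f PiE_iff extensional_def)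
    qed
    show "restrict (\<tau> \<circ> h) U \<in> U \<rightarrow>\<^sub>E {0, 1}"
      using \<tau> by (auto simp: PiE_iff)
    show "wt E ((restrict (\<tau> \<circ> h) U)(r := i)) = wt (map (map_prod h h) E) (\<tau>(h r := i))"
      unfolding wt_map by (rule wt_cong[OF E]) (use hr U in \<open>auto simp: image_iff\<close>)
  next
    fix \<tau> :: "_ \<Rightarrow> nat"
    assume \<tau>: "\<tau> \<in> U \<rightarrow>\<^sub>E {0, 1}"
    show "restrict (restrict (\<tau> \<circ> the_inv_into U h) (h ` U) \<circ> h) U = \<tau>"
    proof
      fix x
      show "restrict (restrict (\<tau> \<circ> the_inv_into U h) (h ` U) \<circ> h) U x = \<tau> x"
        using \<tau> inj by (cases "x \<in> U") (auto simp: the_inv_into_f_f PiE_iff extensional_def)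
    qed
    show "restrict (\<tau> \<circ> the_inv_into U h) (h ` U) \<in> h ` U \<rightarrow>\<^sub>E {0, 1}"
      using \<tau> inj by (auto simp: the_inv_into_f_f PiE_iff)
  qed
  have "edges_in (insert (h r) (h ` U)) (map (map_prod h h) E)"
    using E by (auto simp: edges_in_def)
  then show ?thesis
    using assms(1) unfolding hV rooted_insert_iff[OF hr] bij by (auto simp: U rooted_insert_iff)
qed

text \<open>Every isolated vertex doubles both sums and keeps the ratio; this allows gadgets to be
  padded to a common size.\<close>

lemma rooted_isolated:
  assumes "rooted V E r z0 z1" "finite U" "V \<inter> U = {}"
  shows "rooted (V \<union> U) E r (z0 * 2 ^ card U) (z1 * 2 ^ card U)"
proof -
  have r: "r \<in> V"
    using assms(1) by (simp add: rooted_def)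
  have "rooted (insert r U) [] r (2 ^ card U) (2 ^ card U)"
    using assms r by (subst rooted_insert_iff) (auto simp: card_PiE)
  from rooted_merge[OF assms(1) this] show ?thesis
    using assms(3) r by (auto simp: insert_absorb)
qed

lemma rooted_Rats:
  assumes "rooted V E r z0 z1" "\<beta> \<in> \<rat>" "\<gamma> \<in> \<rat>"
  shows "z0 \<in> \<rat>" "z1 \<in> \<rat>"
proof -
  have "wt E \<sigma> \<in> \<rat>" for \<sigma>
    by (induction E) (use assms in \<open>auto simp: A_entry_def\<close>)
  moreover have "Z \<beta> \<gamma> (mgraph V E) r i = (\<Sum>\<tau>\<in>{\<tau> \<in> V \<rightarrow>\<^sub>E {0, 1}. \<tau> r = i}. wt E \<tau>)" for i
    by (simp add: Z_def prod_edge_weight) (simp add: mgraph_def)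
  ultimately show "z0 \<in> \<rat>" "z1 \<in> \<rat>"
    using assms(1) by (auto simp: rooted_def intro!: Rats_sum)
qed

end

section \<open>Density of the realizable ratios\<close>

lemma additive_semigroup_dense:
  fixes S :: "real set"
  assumes add: "\<And>s t. s \<in> S \<Longrightarrow> t \<in> S \<Longrightarrow> s + t \<in> S"
    and pos: "p \<in> S" "p > 0" and neg: "q \<in> S" "q < 0"
    and close: "\<And>e. e > 0 \<Longrightarrow> \<exists>s\<in>S. \<exists>t\<in>S. s < t \<and> t < s + e"
    and "x < y"
  shows "\<exists>s\<in>S. x < s \<and> s < y"
proof -
  obtain s t where st: "s \<in> S" "t \<in> S" "s < t" "t < s + (y - x)"
    using close[of "y - x"] \<open>x < y\<close> by auto
  define d where "d = t - s"
  have d: "0 < d" "d < y - x"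
    using st by (auto simp: d_def)
  obtain N :: nat where N: "real N * d > max p (- q)"
    using reals_Archimedean3[OF d(1)] by blast
  have mult: "real (Suc n) * u \<in> S" if "u \<in> S" for n u
  proof (induction n)
    case (Suc n)
    then show ?case
      using add[OF that Suc] by (simp add: algebra_simps)
  qed (use that in simp)
  have mult0: "w + real n * u \<in> S" if "u \<in> S" "w \<in> S" for n u w
    using that mult[of u "n - 1"] add by (cases n) auto
  have "N \<noteq> 0"
    using N pos by (intro notI) auto
  then have block: "real N * s + real i * d \<in> S" if "i \<le> N" for i
  proof (cases "i = N")
    case True
    then show ?thesis
      using mult[OF st(2), of "N - 1"] \<open>N \<noteq> 0\<close> by (auto simp: d_def algebra_simps)
  next
    case False
    then have "real N * s + real i * d = real (Suc (N - i - 1)) * s + real i * t"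
      using that by (auto simp: d_def of_nat_diff algebra_simps)
    then show ?thesis
      using mult0[OF st(2) mult[OF st(1)]] by metis
  qed
  \<comment> \<open>The points \<open>N s + i d\<close> for \<open>i \<le> N\<close> form a \<open>d\<close>-net of an interval longer than
    \<open>p\<close> and \<open>-q\<close>, so its translates by multiples of \<open>p\<close> and \<open>q\<close> cover the line.\<close>
  have net: "\<exists>i\<le>N. x < w + real i * d \<and> w + real i * d < y" if "w \<le> x" "x < w + real N * d" for w
  proof -
    define k where "k = nat \<lfloor>(x - w) / d\<rfloor> + 1"
    have k: "real k = of_int \<lfloor>(x - w) / d\<rfloor> + 1"
      using that d by (simp add: k_def)
    have "(x - w) / d < real k" "real k \<le> (x - w) / d + 1"
      unfolding k by linarith+
    then have "x < w + real k * d" "w + real k * d \<le> x + d"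
      using d by (auto simp: field_simps)
    moreover have "(x - w) / d < real N"
      using that d by (simp add: field_simps)
    then have "k \<le> N"
      unfolding k_def using that(1) d(1) by (simp add: floor_less_iff nat_less_iff Suc_le_eq)
    ultimately show ?thesis
      using d by (intro exI[of _ k]) auto
  qed
  show ?thesis
  proof (cases "real N * s \<le> x")
    case True
    \<comment> \<open>The largest number of copies of \<open>p\<close> that keeps the left end of
      the net at or below \<open>x\<close>; the end then lies less than \<open>p\<close> away,
      within reach of the net.\<close>
    define m where "m = nat \<lfloor>(x - real N * s) / p\<rfloor>"
    have m: "real m = of_int \<lfloor>(x - real N * s) / p\<rfloor>"
      using True pos by (simp add: m_def)
    have "real m \<le> (x - real N * s) / p" "(x - real N * s) / p < real m + 1"
      unfolding m by linarith+
    then have "real N * s + real m * p \<le> x" "x < real N * s + real m * p + p"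
      using pos by (auto simp: field_simps)
    moreover have "p < real N * d"
      using N by simp
    ultimately obtain i where i: "i \<le> N" "x < real N * s + real m * p + real i * d"
        "real N * s + real m * p + real i * d < y"
      using net[of "real N * s + real m * p"] by fastforce
    moreover have "real N * s + real m * p + real i * d \<in> S"
      using mult0[OF pos(1) block[OF i(1)], of m] by (simp add: algebra_simps)
    ultimately show ?thesis
      by blast
  next
    case False
    define m where "m = nat \<lceil>(real N * s - x) / (- q)\<rceil>"
    have m: "real m = of_int \<lceil>(real N * s - x) / (- q)\<rceil>"
      using False neg by (simp add: m_def zero_le_divide_iff divide_nonneg_neg)
    have "real m \<ge> (real N * s - x) / (- q)" "(real N * s - x) / (- q) > real m - 1"
      unfolding m by linarith+
    then have "real N * s + real m * q \<le> x" "x < real N * s + real m * q - q"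
      using neg by (auto simp: field_simps)
    moreover have "- q < real N * d"
      using N by simp
    ultimately obtain i where i: "i \<le> N" "x < real N * s + real m * q + real i * d"
        "real N * s + real m * q + real i * d < y"
      using net[of "real N * s + real m * q"] by fastforce
    moreover have "real N * s + real m * q + real i * d \<in> S"
      using mult0[OF neg(1) block[OF i(1)], of m] by (simp add: algebra_simps)
    ultimately show ?thesis
      by blast
  qed
qed

context two_spin
begin

definition realizable :: "real \<Rightarrow> real \<Rightarrow> bool" where
  "realizable z0 z1 \<longleftrightarrow> (\<exists>(m :: nat) D. rooted {..m} D 0 z0 z1)"

lemma realizable_one: "realizable 1 1"
  unfolding realizable_def using rooted_single[of "0 :: nat"] by (metis atMost_0)

lemma realizable_loop: "realizable \<beta> \<gamma>"
  unfolding realizable_def using rooted_loop[of "0 :: nat"] by (metis atMost_0)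

lemma realizable_mult:
  assumes "realizable z0 z1" "realizable w0 w1"
  shows "realizable (z0 * w0) (z1 * w1)"
proof -
  obtain m n :: nat and D D' where D: "rooted {..m} D 0 z0 z1" "rooted {..n} D' 0 w0 w1"
    using assms by (auto simp: realizable_def)
  define h where "h i = (if i = 0 then 0 else i + m)" for i :: nat
  have im: "h ` {..n} = insert 0 {m<..m + n}"
  proof
    show "insert 0 {m<..m + n} \<subseteq> h ` {..n}"
    proof
      fix x assume "x \<in> insert 0 {m<..m + n}"
      then show "x \<in> h ` {..n}"
        by (intro image_eqI[of _ _ "x - m"]) (auto simp: h_def)
    qed
  qed (auto simp: h_def)
  have "inj_on h {..n}"
    by (auto simp: h_def inj_on_def)
  from rooted_rename[OF D(2) this]
  have "rooted (insert 0 {m<..m + n}) (map (map_prod h h) D') 0 w0 w1"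
    unfolding im by (simp add: h_def)
  from rooted_merge[OF D(1) this]
  have "rooted ({..m} \<union> insert 0 {m<..m + n}) (D @ map (map_prod h h) D') 0 (z0 * w0) (z1 * w1)"
    by fastforce
  moreover have "{..m} \<union> insert 0 {m<..m + n} = {..m + n}"
    by auto
  ultimately show ?thesis
    unfolding realizable_def by metis
qed

lemma realizable_extend:
  assumes "realizable z0 z1"
  shows "realizable (\<beta> * z0 + z1) (z0 + \<gamma> * z1)"
proof -
  obtain m :: nat and D where D: "rooted {..m} D 0 z0 z1"
    using assms by (auto simp: realizable_def)
  from rooted_rename[OF D inj_Suc[THEN inj_on_subset, OF subset_UNIV]]
  have "rooted (Suc ` {..m}) (map (map_prod Suc Suc) D) (Suc 0) z0 z1"
    by simp
  from rooted_extend[OF this, of 0] show ?thesis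
    unfolding realizable_def by (metis atMost_Suc_eq_insert_0 image_iff nat.distinct(1))
qed

definition implementable :: "real \<Rightarrow> bool" where
  "implementable a \<longleftrightarrow> (\<exists>z0 z1. realizable z0 z1 \<and> z0 \<noteq> 0 \<and> a = z1 / z0)"

definition edge_map :: "real \<Rightarrow> real" where
  "edge_map r = (1 + \<gamma> * r) / (\<beta> + r)"

lemma implementableI: "realizable z0 z1 \<Longrightarrow> z0 \<noteq> 0 \<Longrightarrow> implementable (z1 / z0)"
  by (auto simp: implementable_def)

lemma implementable_one: "implementable 1"
  using implementableI[OF realizable_one] by simp

lemma implementable_mult:
  assumes "implementable a" "implementable b"
  shows "implementable (a * b)"
  using assms realizable_mult unfolding implementable_def
  by (metis mult_eq_0_iff times_divide_times_eq)

lemma implementable_power: "implementable a \<Longrightarrow> implementable (a ^ n)"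
  by (induction n) (auto intro: implementable_one implementable_mult)

lemma implementable_edge_map:
  assumes "implementable a" "\<beta> + a \<noteq> 0"
  shows "implementable (edge_map a)"
proof -
  obtain z0 z1 where z: "realizable z0 z1" "z0 \<noteq> 0" "a = z1 / z0"
    using assms by (auto simp: implementable_def)
  have "\<beta> * z0 + z1 = z0 * (\<beta> + a)" "z0 + \<gamma> * z1 = z0 * (1 + \<gamma> * a)"
    using z by (auto simp: field_simps)
  then show ?thesis
    using implementableI[OF realizable_extend[OF z(1)]] z assms by (auto simp: edge_map_def)
qed

text \<open>Partial fractions exhibit the limit \<gamma> at infinity and show that the sign of 1 -
  \<beta> \<gamma> decides the side of approach and the monotonicity.\<close>

lemma edge_map_alt: "\<beta> + r \<noteq> 0 \<Longrightarrow> edge_map r = \<gamma> + (1 - \<beta> * \<gamma>) / (\<beta> + r)"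
  by (simp add: edge_map_def field_simps)

end

section \<open>Consequences of the parameter region\<close>

locale spin_region = two_spin +
  assumes region: "(\<beta>, \<gamma>) \<in> param_region"
begin

lemma region_ineqs: "\<gamma> < 0" "\<gamma> < \<beta>" "- 2 < \<beta> + \<gamma>" "\<beta> + \<gamma> < 1" "-1 < \<beta>" "(\<beta>, \<gamma>) \<noteq> (1, -1)"
  using region by (auto simp: param_region_def)

text \<open>For negative \<beta> both parameters are negative, and the inequality of arithmetic and
  geometric means applies with |\<beta> + \<gamma>| < 2; otherwise the product is not
  positive.\<close>

lemma det_pos: "\<beta> * \<gamma> < 1"
proof (cases "\<beta> < 0")
  case True
  have "\<beta> * \<gamma> \<le> ((\<beta> + \<gamma>) / 2)\<^sup>2"
    using sum_squares_ge_zero[of "\<beta> - \<gamma>" 0] by (simp add: power2_eq_square field_simps)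
  also have "\<dots> < 1"
    using region_ineqs True by (intro power2_less_1_iff[THEN iffD2]) (auto simp: abs_if)
  finally show ?thesis .
next
  case False
  then have "\<beta> * \<gamma> \<le> 0"
    using region_ineqs by (auto simp: mult_le_0_iff)
  then show ?thesis
    by simp
qed

lemma implementable_abs_gt_1: "\<exists>y. implementable y \<and> \<bar>y\<bar> > 1"
proof -
  have loop: "implementable (\<gamma> / \<beta>)" if "\<beta> \<noteq> 0"
    using that implementableI[OF realizable_loop] by simp
  consider (neg) "\<beta> + \<gamma> < 0" "\<beta> \<noteq> 0" | (zero) "\<beta> = 0" | (nonneg) "\<beta> + \<gamma> \<ge> 0" "\<beta> > 0" "\<beta> \<noteq> 0"
    using region_ineqs by argo
  then show ?thesis
  proof cases
    case neg
    \<comment> \<open>\<gamma> < \<beta> and \<beta> + \<gamma> < 0 together say \<gamma> <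
      -|\<beta>|.\<close>
    have "\<bar>\<gamma> / \<beta>\<bar> > 1"
      using neg region_ineqs by (auto simp: abs_if divide_simps)
    then show ?thesis
      using loop neg by blast
  next
    case zero
    \<comment> \<open>The loop has no finite ratio here, but hung on a new root it has ratio
      \<gamma>. This settles \<gamma> < -1; at \<gamma> = -1 one more edge gives -2, and for
      \<gamma> > -1 a path with two edges and no loop works.\<close>
    have g: "realizable \<gamma> (\<gamma>\<^sup>2)"
      using realizable_extend[OF realizable_loop] zero by (simp add: power2_eq_square)
    consider "\<gamma> < -1" | "\<gamma> = -1" | "-1 < \<gamma>"
      by linarith
    then show ?thesis
    proof cases
      case 1
      then show ?thesis
        using implementableI[OF g] by (intro exI[of _ \<gamma>]) (auto simp: power2_eq_square)
    next
      case 2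
      then show ?thesis
        using implementableI[OF realizable_extend[OF g]] zero by (intro exI[of _ "-2"]) auto
    next
      case 3
      have "edge_map 1 = 1 + \<gamma>"
        unfolding edge_map_def using zero by simp
      then have "implementable (edge_map (edge_map 1))"
        using zero 3 by (intro implementable_edge_map implementable_one) simp_all
      moreover have "edge_map (edge_map 1) = 1 + \<gamma>\<^sup>2 / (1 + \<gamma>)"
        unfolding \<open>edge_map 1 = 1 + \<gamma>\<close> unfolding edge_map_def
        using zero 3 by (simp add: field_simps power2_eq_square)
      moreover have "\<gamma>\<^sup>2 / (1 + \<gamma>) > 0"
        using 3 region_ineqs by auto
      ultimately show ?thesis
        by (intro exI[of _ "edge_map (edge_map 1)"]) simp
    qed
  next
    case nonneg
    show ?thesis
    \<comment> \<open>The candidate is a looped vertex hung on the root, with ratio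
      \<open>(\<beta> + \<gamma>\<^sup>2) / (\<beta>\<^sup>2 + \<gamma>)\<close>. Numerator minus
      denominator factors as (\<beta> - \<gamma>) (1 - (\<beta> + \<gamma>)), which is where \<beta>
      + \<gamma> < 1 enters. The exceptional case is that the loop ratio hits the pole.\<close>
    proof (cases "\<beta>\<^sup>2 + \<gamma> = 0")
      case False
      have "\<beta> + \<gamma> / \<beta> \<noteq> 0"
        using False nonneg by (simp add: field_simps power2_eq_square)
      then have "implementable (edge_map (\<gamma> / \<beta>))"
        by (intro implementable_edge_map loop nonneg)
      moreover have eq: "edge_map (\<gamma> / \<beta>) = (\<beta> + \<gamma>\<^sup>2) / (\<beta>\<^sup>2 + \<gamma>)"
      proof -
        have "1 + \<gamma> * (\<gamma> / \<beta>) = (\<beta> + \<gamma>\<^sup>2) / \<beta>" "\<beta> + \<gamma> / \<beta> = (\<beta>\<^sup>2 + \<gamma>) / \<beta>"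
          using nonneg by (auto simp: field_simps power2_eq_square)
        then show ?thesis
          using nonneg unfolding edge_map_def by simp
      qed
      moreover have "\<bar>\<beta>\<^sup>2 + \<gamma>\<bar> < \<beta> + \<gamma>\<^sup>2"
      proof -
        have "(\<beta> - \<gamma>) * (1 - (\<beta> + \<gamma>)) > 0" "\<beta>\<^sup>2 > 0" "\<gamma>\<^sup>2 > 0"
          using region_ineqs nonneg by (auto simp: mult_pos_pos)
        then show ?thesis
          using nonneg(1) by (simp add: algebra_simps power2_eq_square)
      qed
      ultimately show ?thesis
        using False by (intro exI[of _ "edge_map (\<gamma> / \<beta>)"]) (auto simp: abs_divide)
    next
      case True
      then have \<gamma>: "\<gamma> = - (\<beta>\<^sup>2)"
        by simp
      have "\<beta> \<le> 1"
        using nonneg by (simp add: \<gamma> power2_eq_square)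
      \<comment> \<open>The removed point (1, -1) is exactly the point with \<beta> = 1 on this
        curve.\<close>
      moreover have "\<beta> \<noteq> 1"
        using region_ineqs(6) \<gamma> by auto
      ultimately have "\<beta> < 1"
        by simp
      \<comment> \<open>Three loops instead of one move the ratio from the pole -\<beta> to
        \<open>- (\<beta> ^ 3)\<close>, still negative, so that the denominator of
        \<open>edge_map\<close> lies strictly between 0 and 1 while the numerator exceeds 1.\<close>
      have gb: "(\<gamma> / \<beta>) ^ 3 = - (\<beta> ^ 3)"
        using nonneg by (simp add: \<gamma> power2_eq_square power3_eq_cube)
      have b3: "\<beta> ^ 3 < \<beta>"
        using \<open>\<beta> < 1\<close> nonneg power_strict_decreasing[of 1 3 \<beta>] by simp
      have "implementable (edge_map (- (\<beta> ^ 3)))"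
        using implementable_edge_map[OF implementable_power[OF loop], of 3] nonneg b3
        unfolding gb by simp
      moreover have "\<beta> - \<beta> ^ 3 < 1 + \<beta>\<^sup>2 * \<beta> ^ 3"
      proof -
        have "\<beta> ^ 3 > 0" "\<beta>\<^sup>2 * \<beta> ^ 3 > 0"
          using nonneg by simp_all
        then show ?thesis
          using \<open>\<beta> < 1\<close> by linarith
      qed
      then have "edge_map (- (\<beta> ^ 3)) > 1"
        using b3 unfolding edge_map_def by (simp add: \<gamma>)
      ultimately show ?thesis
        by (intro exI[of _ "edge_map (- (\<beta> ^ 3))"]) auto
    qed
  qed
qed

lemma edge_map_tendsto: "(edge_map \<longlongrightarrow> \<gamma>) at_top"
proof -
  have "((\<lambda>r. \<gamma> + (1 - \<beta> * \<gamma>) / (\<beta> + r)) \<longlongrightarrow> \<gamma> + 0) at_top"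
    by (intro tendsto_add tendsto_const tendsto_divide_0[OF tendsto_const]
        filterlim_at_top_imp_at_infinity filterlim_tendsto_add_at_top[OF tendsto_const] filterlim_ident)
  moreover have "\<forall>\<^sub>F r in at_top. \<gamma> + (1 - \<beta> * \<gamma>) / (\<beta> + r) = edge_map r"
    using eventually_gt_at_top[of "- \<beta>"] by eventually_elim (simp add: edge_map_alt)
  ultimately show ?thesis
    by (simp add: tendsto_cong)
qed

text \<open>Squaring a ratio of absolute value above 1 gives a base \<open>y\<close> > 1 whose
  powers tend to plus infinity. Dropping finitely many of them passes the pole and makes all values
  negative; \<beta> \<gamma> < 1 makes the rest strictly decreasing, hence distinct.\<close>

lemma implementable_seq:
  obtains y a where "implementable y" "y > 1" "\<And>n. implementable (a n)" "a \<longlonglongrightarrow> \<gamma>"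
    "\<And>n. \<gamma> < a (Suc n)" "\<And>n. a (Suc n) < a n" "\<And>n. a n < 0"
proof -
  obtain y0 where y0: "implementable y0" "\<bar>y0\<bar> > 1"
    using implementable_abs_gt_1 by blast
  define y where "y = y0\<^sup>2"
  have y: "implementable y" "y > 1"
    using y0 implementable_power[OF y0(1), of 2] one_less_power[of "\<bar>y0\<bar>" 2] by (auto simp: y_def)
  have lim: "filterlim (\<lambda>n. y ^ n) at_top sequentially"
    by (intro filterlim_at_infinity_imp_filterlim_at_top filterlim_realpow_sequentially_gt1)
      (use y in auto)
  have "\<forall>\<^sub>F n in sequentially. edge_map (y ^ n) < 0"
    using order_tendstoD(2)[OF filterlim_compose[OF edge_map_tendsto lim]] region_ineqs(1) by blast
  moreover have "\<forall>\<^sub>F n in sequentially. y ^ n > - \<beta>"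
    using lim by (simp add: filterlim_at_top_dense)
  ultimately have "\<forall>\<^sub>F n in sequentially. edge_map (y ^ n) < 0 \<and> y ^ n > - \<beta>"
    by eventually_elim auto
  then obtain N where N: "\<And>n. n \<ge> N \<Longrightarrow> edge_map (y ^ n) < 0 \<and> y ^ n > - \<beta>"
    by (auto simp: eventually_sequentially)
  define a where "a n = edge_map (y ^ (n + N))" for n
  have alt: "a n = \<gamma> + (1 - \<beta> * \<gamma>) / (\<beta> + y ^ (n + N))" "\<beta> + y ^ (n + N) > 0" for n
    using N[of "n + N"] edge_map_alt[of "y ^ (n + N)"] by (auto simp: a_def)
  show ?thesis
  proof (rule that[OF y, of a])
    show "implementable (a n)" for n
      unfolding a_def using alt(2)[of n] by (intro implementable_edge_map implementable_power y) simp
    show "a \<longlonglongrightarrow> \<gamma>"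
      using LIMSEQ_ignore_initial_segment[OF filterlim_compose[OF edge_map_tendsto lim], of N]
      by (simp add: a_def[abs_def])
    show "\<gamma> < a (Suc n)" for n
      using alt[of "Suc n"] det_pos by simp
    have "\<beta> + y ^ (n + N) < \<beta> + y ^ (Suc n + N)" for n
      using y(2) by simp
    then show "a (Suc n) < a n" for n
      unfolding alt(1) using alt(2)[of n] alt(2)[of "Suc n"] det_pos
      by (intro add_strict_left_mono divide_strict_left_mono) auto
    show "a n < 0" for n
      using N[of "n + N"] by (simp add: a_def)
  qed
qed

text \<open>The semigroup is that of the logarithms of nonzero absolute values. Its close pairs are
  consecutive terms of the sequence converging to \<gamma>: convergence makes them close, strict
  monotonicity makes them distinct.\<close>

lemma implementable_abs_dense:
  assumes "0 < u" "u < v"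
  shows "\<exists>a. implementable a \<and> u < \<bar>a\<bar> \<and> \<bar>a\<bar> < v"
proof -
  obtain y a where y: "implementable y" "y > 1" and a: "\<And>n. implementable (a n)" "a \<longlonglongrightarrow> \<gamma>"
    "\<And>n. \<gamma> < a (Suc n)" "\<And>n. a (Suc n) < a n" "\<And>n. a n < 0"
    using implementable_seq by blast
  define S where "S = {ln \<bar>a\<bar> | a. implementable a \<and> a \<noteq> 0}"
  have SI: "implementable x \<Longrightarrow> x \<noteq> 0 \<Longrightarrow> ln \<bar>x\<bar> \<in> S" for x
    by (auto simp: S_def)
  have small: "\<exists>q\<in>S. q < 0"
  proof -
    \<comment> \<open>|\<open>edge_map 1\<close>| < 1 amounts to |1 + \<gamma>| < 1 + \<beta>, that
      is, \<gamma> < \<beta> and -2 < \<beta> + \<gamma>. At \<gamma> = -1 this value is 0 and has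
      no logarithm; there the terms of the sequence themselves lie between -1 and 0.\<close>
    have "\<exists>x. implementable x \<and> x \<noteq> 0 \<and> \<bar>x\<bar> < 1"
    proof (cases "\<gamma> = -1")
      case True
      then show ?thesis
        using a(3)[of 0] a(5)[of 1] a(1)[of 1] by (intro exI[of _ "a 1"]) auto
    next
      case False
      have "implementable (edge_map 1)"
        using region_ineqs by (intro implementable_edge_map implementable_one) auto
      moreover have "edge_map 1 \<noteq> 0" "\<bar>edge_map 1\<bar> < 1"
        using region_ineqs False by (auto simp: edge_map_def abs_if divide_simps)
      ultimately show ?thesis
        by blast
    qed
    then show ?thesis
      using SI by force
  qed
  then obtain q where q: "q \<in> S" "q < 0"
    by blast
  have "\<exists>s\<in>S. ln u < s \<and> s < ln v"
  proof (rule additive_semigroup_dense[of S "ln \<bar>y\<bar>" q])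
    fix s t assume "s \<in> S" "t \<in> S"
    then obtain b c where "s = ln \<bar>b\<bar>" "t = ln \<bar>c\<bar>" "implementable b" "implementable c" "b \<noteq> 0" "c \<noteq> 0"
      by (auto simp: S_def)
    then show "s + t \<in> S"
      using SI[of "b * c"] implementable_mult by (auto simp: abs_mult ln_mult)
  next
    fix e :: real assume "e > 0"
    have "(\<lambda>n. ln \<bar>a n\<bar>) \<longlonglongrightarrow> ln \<bar>\<gamma>\<bar>"
      by (intro tendsto_intros a) (use region_ineqs in auto)
    then have "Cauchy (\<lambda>n. ln \<bar>a n\<bar>)"
      by (rule LIMSEQ_imp_Cauchy)
    then obtain M where "\<And>m n. m \<ge> M \<Longrightarrow> n \<ge> M \<Longrightarrow> norm (ln \<bar>a m\<bar> - ln \<bar>a n\<bar>) < e"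
      using \<open>e > 0\<close> by (metis CauchyD)
    from this[of "Suc M" M] have "ln \<bar>a (Suc M)\<bar> < ln \<bar>a M\<bar> + e"
      by auto
    moreover have "ln \<bar>a M\<bar> < ln \<bar>a (Suc M)\<bar>"
      using a(4)[of M] a(5)[of M] a(5)[of "Suc M"] by simp
    ultimately show "\<exists>s\<in>S. \<exists>t\<in>S. s < t \<and> t < s + e"
      using SI[OF a(1)] a(5) by (metis less_irrefl)
  qed (use y q assms SI[of y] in auto)
  then obtain b where "implementable b" "b \<noteq> 0" "ln u < ln \<bar>b\<bar>" "ln \<bar>b\<bar> < ln v"
    by (auto simp: S_def)
  then show ?thesis
    using assms by auto
qed

text \<open>Squares of ratios whose absolute value lies between the square roots of the bounds are
  positive.\<close>

lemma implementable_pos_dense: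
  assumes "0 < u" "u < v"
  obtains a where "implementable a" "u < a" "a < v"
proof -
  obtain a where "implementable a" "sqrt u < \<bar>a\<bar>" "\<bar>a\<bar> < sqrt v"
    using implementable_abs_dense[of "sqrt u" "sqrt v"] assms by auto
  then have "implementable (a\<^sup>2)" "sqrt u < sqrt (a\<^sup>2)" "sqrt (a\<^sup>2) < sqrt v"
    by (auto intro: implementable_power)
  then show ?thesis
    using that by (metis real_sqrt_less_iff)
qed

text \<open>A single negative ratio carries the density of the positive ones over.\<close>

lemma implementable_neg_dense:
  assumes "0 < u" "u < v"
  obtains a where "implementable a" "u < - a" "- a < v" 
proof -
  obtain b where b: "implementable b" "b < 0"
    using implementable_seq by metis
  have "0 < u / (- b)" "u / (- b) < v / (- b)"
    using assms b by (auto simp: divide_simps)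
  then obtain a where "implementable a" "u / (- b) < a" "a < v / (- b)"
    using implementable_pos_dense by blast
  then show ?thesis
    using that[of "a * b"] implementable_mult b by (auto simp: divide_simps split: if_splits)
qed

end

section \<open>Approximation by an iterated function system\<close>

text \<open>In logarithmic coordinates the derivative of \<open>- edge_map\<close> is \<delta> r /
  ((\<beta> + r) (-\<gamma> r - 1)), of order 1/r. The proof replaces calculus by
  \<open>ln q \<le> q - 1\<close>, applied to the quotient of the values and to
  \<open>r / s\<close>.\<close>

lemma (in spin_region) edge_map_contraction:
  obtains \<rho> where "\<rho> > 0" "\<And>r. r \<ge> \<rho> \<Longrightarrow> \<beta> + r > 0" "\<And>r. r \<ge> \<rho> \<Longrightarrow> edge_map r < 0"
    "\<And>r s. r \<ge> \<rho> \<Longrightarrow> s \<ge> \<rho> \<Longrightarrow>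
      \<bar>ln (- edge_map r) - ln (- edge_map s)\<bar> \<le> \<bar>ln r - ln s\<bar> / 2"
proof
  define \<delta> where "\<delta> = 1 - \<beta> * \<gamma>"
  \<comment> \<open>The first entry gives \<beta> + s at least s/2, the second -\<gamma> r - 1 at
    least 4 \<delta>; the derivative is then at most \<delta> / (4 \<delta> / 2) = 1/2.\<close>
  define \<rho> where "\<rho> = max (2 * \<bar>\<beta>\<bar> + 1) ((1 + 4 * \<delta>) / (- \<gamma>))"
  have \<delta>: "\<delta> > 0"
    using det_pos by (simp add: \<delta>_def)
  show \<rho>0: "\<rho> > 0"
    unfolding \<rho>_def less_max_iff_disj by (intro disjI1) linarith
  have half: "s / 2 \<le> \<beta> + s" if "s \<ge> \<rho>" for s
    using that by (auto simp: \<rho>_def)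
  have num: "- \<gamma> * r - 1 \<ge> 4 * \<delta>" if "r \<ge> \<rho>" for r
    using that region_ineqs by (auto simp: \<rho>_def field_simps)
  show pos: "\<beta> + r > 0" if "r \<ge> \<rho>" for r
    using half[OF that] that \<rho>0 by simp
  show neg: "edge_map r < 0" if "r \<ge> \<rho>" for r
    using pos[OF that] num[OF that] \<delta> by (auto simp: edge_map_def divide_less_0_iff)
  have le: "\<bar>ln (- edge_map r) - ln (- edge_map s)\<bar> \<le> \<bar>ln r - ln s\<bar> / 2"
    if rs: "\<rho> \<le> r" "r \<le> s" for r s
  proof -
    have s: "\<rho> \<le> s"
      using rs by simp
    define q where "q = edge_map s / edge_map r"
    have nr: "- \<gamma> * r - 1 > 0"
      using num[OF rs(1)] \<delta> by simp
    have "q = (1 + \<gamma> * s) * (\<beta> + r) / ((\<beta> + s) * (1 + \<gamma> * r))"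
      using pos[OF rs(1)] pos[OF s] by (simp add: q_def edge_map_def)
    then have "q - 1 = ((1 + \<gamma> * s) * (\<beta> + r) - (\<beta> + s) * (1 + \<gamma> * r)) / ((\<beta> + s) * (1 + \<gamma> * r))"
      using nr pos[OF s] by (simp add: diff_divide_distrib)
    also have "(1 + \<gamma> * s) * (\<beta> + r) - (\<beta> + s) * (1 + \<gamma> * r) = - (\<delta> * (s - r))"
      by (simp add: \<delta>_def algebra_simps)
    also have "(\<beta> + s) * (1 + \<gamma> * r) = - ((\<beta> + s) * (- \<gamma> * r - 1))"
      by (simp add: algebra_simps)
    finally have q: "q - 1 = \<delta> * (s - r) / ((\<beta> + s) * (- \<gamma> * r - 1))"
      by simp
    have "q - 1 \<ge> 0"
      unfolding q using \<delta> rs nr pos[OF s] by (intro divide_nonneg_nonneg mult_nonneg_nonneg) auto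
    have "q - 1 \<le> \<delta> * (s - r) / ((s / 2) * (4 * \<delta>))"
      unfolding q
    proof (rule divide_left_mono)
      show "s / 2 * (4 * \<delta>) \<le> (\<beta> + s) * (- \<gamma> * r - 1)"
        using half[OF s] num[OF rs(1)] \<delta> pos[OF s] by (intro mult_mono) auto
      show "0 < (\<beta> + s) * (- \<gamma> * r - 1) * (s / 2 * (4 * \<delta>))"
        using \<delta> nr pos[OF s] \<rho>0 s by (intro mult_pos_pos) auto
    qed (use rs \<delta> in simp)
    also have "\<dots> = (1 - r / s) / 2"
      using \<delta> \<rho>0 s by (simp add: field_simps)
    also have "\<dots> \<le> (ln s - ln r) / 2"
      using ln_le_minus_one[of "r / s"] rs \<rho>0 s by (simp add: ln_div)
    finally have "q - 1 \<le> (ln s - ln r) / 2" .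
    moreover have "ln q = ln (- edge_map s) - ln (- edge_map r)"
      using ln_div[of "- edge_map s" "- edge_map r"] neg[OF rs(1)] neg[OF s] by (simp add: q_def)
    moreover have "ln q \<le> q - 1" "ln q \<ge> 0"
      using \<open>q - 1 \<ge> 0\<close> by (auto intro: ln_le_minus_one)
    moreover have "ln r \<le> ln s"
      using rs \<rho>0 by simp
    ultimately show ?thesis
      by simp
  qed
  show "\<bar>ln (- edge_map r) - ln (- edge_map s)\<bar> \<le> \<bar>ln r - ln s\<bar> / 2"
    if "r \<ge> \<rho>" "s \<ge> \<rho>" for r s
    using le[of r s] le[of s r] that by (cases "r \<le> s") (auto simp: abs_minus_commute)
qed

text \<open>For each target the suitable multipliers form a nonempty open interval, so density
  provides one. Open images allow compactness, and they put \<open>t\<close> strictly inside the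
  window, which a strict integer inequality can detect.\<close>

lemma (in spin_region) edge_map_cover:
  assumes "0 < lo" "lo < hi" and pos: "\<And>r. r \<ge> lo \<Longrightarrow> \<beta> + r > 0"
    and neg: "\<And>r. r \<ge> lo \<Longrightarrow> edge_map r < 0"
  obtains S where "finite S" "\<And>a. a \<in> S \<Longrightarrow> implementable a \<and> a < 0"
    "\<And>x. lo \<le> x \<Longrightarrow> x \<le> hi \<Longrightarrow> \<exists>a\<in>S. \<exists>t. lo < t \<and> t < hi \<and> x = a * edge_map t"
proof -
  \<comment> \<open>The image of the open window under \<open>\<lambda>t. a * edge_map t\<close>,
    written with positive factors.\<close>
  define U where "U a = {- a * (- edge_map lo) <..< - a * (- edge_map hi)}" for a
  define S0 where "S0 = {a. implementable a \<and> a < 0}"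
  have "(1 - \<beta> * \<gamma>) / (\<beta> + hi) < (1 - \<beta> * \<gamma>) / (\<beta> + lo)"
    using pos[of lo] pos[of hi] assms det_pos by (intro divide_strict_left_mono) auto
  then have fl: "edge_map hi < edge_map lo"
    using edge_map_alt[of hi] edge_map_alt[of lo] pos[of lo] pos[of hi] assms(1,2) by simp
  have cover: "{lo..hi} \<subseteq> (\<Union>a\<in>S0. U a)"
  proof
    fix x assume x: "x \<in> {lo..hi}"
    have "0 < x / (- edge_map hi)" "x / (- edge_map hi) < x / (- edge_map lo)"
      using fl x assms(1) neg[of lo] neg[of hi] assms(2)
      by (auto intro: divide_pos_neg mult_neg_neg intro!: divide_strict_left_mono)
    then obtain a where "implementable a" "x / (- edge_map hi) < - a" "- a < x / (- edge_map lo)"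
      using implementable_neg_dense by blast
    moreover from this have "a < 0"
      using \<open>0 < x / (- edge_map hi)\<close> by linarith
    ultimately have "a \<in> S0" "x \<in> U a"
      using neg[of lo] neg[of hi] assms(2) by (auto simp: S0_def U_def field_simps)
    then show "x \<in> (\<Union>a\<in>S0. U a)"
      by blast
  qed
  obtain S where S: "S \<subseteq> S0" "finite S" "{lo..hi} \<subseteq> (\<Union>a\<in>S. U a)"
    by (rule compactE_image[OF compact_Icc _ cover]) (auto simp: U_def)
  show ?thesis
  proof (rule that[OF S(2)])
    show "implementable a \<and> a < 0" if "a \<in> S" for a
      using that S(1) by (auto simp: S0_def)
    fix x assume "lo \<le> x" "x \<le> hi"
    then obtain a where a: "a \<in> S" "x \<in> U a"
      using S(3) by fastforce
    then have a0: "a < 0"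
      using S(1) by (auto simp: S0_def)
    have y: "edge_map hi < x / a" "x / a < edge_map lo"
      using a(2) a0 by (auto simp: U_def field_simps)
    have "continuous_on {lo..hi} edge_map"
      unfolding edge_map_def[abs_def] by (intro continuous_intros) (use pos in force)
    from IVT2'[OF _ _ _ this, of "x / a"] y assms(2)
    obtain t where t: "lo \<le> t" "t \<le> hi" "edge_map t = x / a"
      by auto
    then have "t \<noteq> lo" "t \<noteq> hi"
      using y by auto
    then show "\<exists>a\<in>S. \<exists>t. lo < t \<and> t < hi \<and> x = a * edge_map t"
      using a(1) a0 t by (intro bexI[of _ a] exI[of _ t]) auto
  qed
qed

text \<open>A move attaches \<open>gadget\<close> to the current vertex and, if \<open>linked\<close>, continues at a new vertex
  joined to it by an edge. The matrix takes the ratio \<open>p / q\<close> wanted at the current vertex to the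
  ratio wanted from the rest of the graph.\<close>

datatype move = Move (linked: bool) (gadget: "(nat \<times> nat) list")
  (m11: int) (m12: int) (m21: int) (m22: int)

definition new_p :: "move \<Rightarrow> int \<Rightarrow> int \<Rightarrow> int" where
  "new_p M p q = m11 M * p + m12 M * q"

definition new_q :: "move \<Rightarrow> int \<Rightarrow> int \<Rightarrow> int" where
  "new_q M p q = m21 M * p + m22 M * q"

text \<open>A gadget uses vertices below \<open>K\<close>, so \<open>K\<close> is its first free
  label; \<open>emb c b\<close> sends it to \<open>b + K\<close>, the next current vertex.\<close>

definition move_edges :: "nat \<Rightarrow> move \<Rightarrow> (nat \<times> nat) list" where
  "move_edges K M = gadget M @ (if linked M then [(0, K)] else [])"

text \<open>Vertex \<open>0\<close> of a gadget is identified with the current vertex \<open>c\<close>; its other vertices are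
  placed above the last vertex \<open>b\<close> in use.\<close>

definition emb :: "nat \<Rightarrow> nat \<Rightarrow> nat \<Rightarrow> nat" where
  "emb c b i = (if i = 0 then c else b + i)"

abbreviation emb_edges :: "nat \<Rightarrow> nat \<Rightarrow> (nat \<times> nat) list \<Rightarrow> (nat \<times> nat) list" where
  "emb_edges c b \<equiv> map (map_prod (emb c b) (emb c b))"

context two_spin
begin

definition has_ratio :: "nat \<Rightarrow> (nat \<times> nat) list \<Rightarrow> real \<Rightarrow> bool" where
  "has_ratio k D a \<longleftrightarrow> (\<exists>w. rooted {..<k} D 0 w (a * w) \<and> w \<noteq> 0)"

text \<open>Padding gives all gadgets the same number of vertices, so the vertex count depends only
  on the number of moves.\<close>

lemma has_ratio_mono:
  assumes "has_ratio k D a" "k \<le> k'"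
  shows "has_ratio k' D a"
proof -
  obtain w0 where w: "rooted {..<k} D 0 w0 (a * w0)" "w0 \<noteq> 0"
    using assms(1) unfolding has_ratio_def by blast
  define N where "N = card {k..<k'}"
  have "rooted ({..<k} \<union> {k..<k'}) D 0 (w0 * 2 ^ N) (a * w0 * 2 ^ N)"
    unfolding N_def by (rule rooted_isolated[OF w(1)]) auto
  moreover have "{..<k} \<union> {k..<k'} = {..<k'}"
    using assms(2) by (rule ivl_disj_un_one(2))
  ultimately have "rooted {..<k'} D 0 (w0 * 2 ^ N) (a * (w0 * 2 ^ N))"
    by (simp only: mult.assoc)
  moreover have "w0 * 2 ^ N \<noteq> 0"
    using w(2) by simp
  ultimately show ?thesis
    unfolding has_ratio_def by blast
qed

lemma implementable_has_ratio: "implementable a \<Longrightarrow> \<exists>k D. has_ratio k D a"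
proof -
  assume "implementable a"
  then obtain z0 z1 D and m :: nat where "rooted {..m} D 0 z0 z1" "z0 \<noteq> 0" "a = z1 / z0"
    unfolding implementable_def realizable_def by blast
  then have "rooted {..<Suc m} D 0 z0 (a * z0)"
    by (simp add: lessThan_Suc_atMost)
  then have "has_ratio (Suc m) D a"
    unfolding has_ratio_def using \<open>z0 \<noteq> 0\<close> by blast
  then show ?thesis
    by blast
qed

lemma has_ratio_emb:
  assumes "has_ratio k D a" "c \<le> b"
  shows "\<exists>w. rooted (insert c {b<..<b + k}) (emb_edges c b D) c w (a * w) \<and> w \<noteq> 0"
proof -
  obtain w where w: "rooted {..<k} D 0 w (a * w)" "w \<noteq> 0"
    using assms unfolding has_ratio_def by blast
  then have "k > 0"
    by (auto simp: rooted_def)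
  have "inj_on (emb c b) {..<k}"
    using assms(2) by (auto simp: inj_on_def emb_def)
  moreover have "emb c b ` {..<k} = insert c {b<..<b + k}"
  proof
    show "insert c {b<..<b + k} \<subseteq> emb c b ` {..<k}"
    proof
      fix x assume "x \<in> insert c {b<..<b + k}"
      then consider "x = c" | "x \<in> {b<..<b + k}" by blast
      then show "x \<in> emb c b ` {..<k}"
      proof cases
        case 1
        then show ?thesis
          using \<open>k > 0\<close> by (intro image_eqI[of _ _ 0]) (auto simp: emb_def)
      next
        case 2
        then show ?thesis
          by (intro image_eqI[of _ _ "x - b"]) (auto simp: emb_def)
      qed
    qed
  qed (auto simp: emb_def)
  ultimately show ?thesis
    using rooted_rename[OF w(1), of "emb c b"] w(2) by (intro exI[of _ w]) (simp add: emb_def[of c b 0])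
qed

end

text \<open>The moves \<open>up\<close> and \<open>dn\<close> bring the target into the window \<open>[lo, hi]\<close>; the moves in \<open>Ms\<close> are
  inverse branches of contractions \<open>\<lambda>t. a * edge_map t\<close> whose images of the window cover it.
  Contraction is required down to \<open>lo\<^sup>2 / hi\<close> because the realized ratio may miss a target in the
  window by a factor of up to \<open>hi / lo\<close>.\<close>

locale approximation_scheme = spin_region +
  fixes K :: nat and lo hi :: int and up dn :: move and Ms :: "move list"
    and F :: "(nat \<times> nat) list" and \<mu> :: nat
  assumes K: "K > 0" and lo: "0 < lo" and lo_hi: "lo < hi"
    and contr_pos: "\<And>r. r \<ge> of_int (lo\<^sup>2) / of_int hi \<Longrightarrow> \<beta> + r > 0 \<and> edge_map r < 0"
    and contr: "\<And>r s. r \<ge> of_int (lo\<^sup>2) / of_int hi \<Longrightarrow> s \<ge> of_int (lo\<^sup>2) / of_int hi \<Longrightarrow>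
      \<bar>ln (- edge_map r) - ln (- edge_map s)\<bar> \<le> \<bar>ln r - ln s\<bar> / 2"
    and up: "\<not> linked up" "\<exists>a. 2 \<le> a \<and> a \<le> of_int hi / of_int lo \<and> has_ratio K (gadget up) a \<and>
      (\<forall>p q. q \<noteq> 0 \<longrightarrow> new_q up p q \<noteq> 0 \<and>
        real_of_int p / of_int q = a * (of_int (new_p up p q) / of_int (new_q up p q)))"
    and dn: "\<not> linked dn" "\<exists>a. of_int lo / of_int hi \<le> a \<and> 0 < a \<and> a \<le> 1 / 2 \<and> has_ratio K (gadget dn) a \<and>
      (\<forall>p q. q \<noteq> 0 \<longrightarrow> new_q dn p q \<noteq> 0 \<and>
        real_of_int p / of_int q = a * (of_int (new_p dn p q) / of_int (new_q dn p q)))"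
    and Ms: "\<And>M. M \<in> set Ms \<Longrightarrow> linked M \<and> (\<exists>a<0. has_ratio K (gadget M) a \<and>
      (\<forall>p q. q \<noteq> 0 \<longrightarrow> new_q M p q \<noteq> 0 \<longrightarrow> of_int (new_p M p q) / of_int (new_q M p q) > real_of_int lo \<longrightarrow>
        real_of_int p / of_int q = a * edge_map (of_int (new_p M p q) / of_int (new_q M p q))))"
    and cover: "\<And>p q. q \<noteq> 0 \<Longrightarrow> real_of_int lo \<le> of_int p / of_int q \<Longrightarrow>
      of_int p / of_int q \<le> real_of_int hi \<Longrightarrow>
      \<exists>M\<in>set Ms. (new_p M p q - lo * new_q M p q) * (hi * new_q M p q - new_p M p q) > 0"
    and F: "\<exists>a. of_int lo \<le> a \<and> a \<le> of_int hi \<and> has_ratio K F a"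
    and \<mu>: "\<And>M. M \<in> set (up # dn # Ms) \<Longrightarrow>
      \<bar>m11 M\<bar> + \<bar>m12 M\<bar> \<le> 2 ^ \<mu> \<and> \<bar>m21 M\<bar> + \<bar>m22 M\<bar> \<le> 2 ^ \<mu>"
begin

text \<open>For a target in the window \<open>cover\<close> guarantees a successful test. The
  fallback \<open>up\<close> keeps the result among the moves bounded by \<mu> for every
  input.\<close>

fun pick :: "move list \<Rightarrow> int \<Rightarrow> int \<Rightarrow> move" where
  "pick [] p q = up"
| "pick (M # L) p q =
    (if (new_p M p q - lo * new_q M p q) * (hi * new_q M p q - new_p M p q) > 0 then M else pick L p q)"

definition choose_move :: "int \<Rightarrow> int \<Rightarrow> move" where
  "choose_move p q = (if (p - hi * q) * q > 0 then up else if (lo * q - p) * q > 0 then dn else pick Ms p q)"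

fun build :: "nat \<Rightarrow> int \<Rightarrow> int \<Rightarrow> nat \<Rightarrow> nat \<Rightarrow> (nat \<times> nat) list" where
  "build 0 p q c b = emb_edges c b F"
| "build (Suc j) p q c b = emb_edges c b (move_edges K (choose_move p q)) @
    build j (new_p (choose_move p q) p q) (new_q (choose_move p q) p q)
      (if linked (choose_move p q) then b + K else c) (b + K)"

lemma pick_in: "pick L p q \<in> set (up # L)"
  by (induction L) auto

lemma choose_move_in: "choose_move p q \<in> set (up # dn # Ms)"
  using pick_in[of Ms p q] by (auto simp: choose_move_def)

lemma pick_test:
  assumes "\<exists>M\<in>set L. (new_p M p q - lo * new_q M p q) * (hi * new_q M p q - new_p M p q) > 0"
  shows "pick L p q \<in> set L \<and>
    (new_p (pick L p q) p q - lo * new_q (pick L p q) p q) *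
    (hi * new_q (pick L p q) p q - new_p (pick L p q) p q) > 0"
  using assms by (induction L) auto

text \<open>The moves need not preserve the sign of the denominator. Multiplying the comparison by
  the square of \<open>q\<close> makes it independent of that sign.\<close>

lemma guard_iff:
  fixes p q h :: int
  assumes "q \<noteq> 0"
  shows "(p - h * q) * q > 0 \<longleftrightarrow> real_of_int p / of_int q > of_int h"
    and "(h * q - p) * q > 0 \<longleftrightarrow> real_of_int p / of_int q < of_int h"
proof -
  have "real_of_int ((p - h * q) * q) = (real_of_int p / of_int q - of_int h) * (of_int q)\<^sup>2"
    using assms by (simp add: field_simps power2_eq_square)
  moreover have "(real_of_int q)\<^sup>2 > 0"
    using assms by simp
  ultimately have eq: "real_of_int ((p - h * q) * q) > 0 \<longleftrightarrow> real_of_int p / of_int q > of_int h"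
    "real_of_int ((p - h * q) * q) < 0 \<longleftrightarrow> real_of_int p / of_int q < of_int h"
    by (auto simp: zero_less_mult_iff mult_less_0_iff)
  then show "(p - h * q) * q > 0 \<longleftrightarrow> real_of_int p / of_int q > of_int h"
    using of_int_0_less_iff by blast
  have "(h * q - p) * q = - ((p - h * q) * q)"
    by (simp add: algebra_simps)
  then show "(h * q - p) * q > 0 \<longleftrightarrow> real_of_int p / of_int q < of_int h"
    using eq(2) of_int_less_0_iff by (metis neg_0_less_iff_less)
qed

text \<open>Both factors must have the same sign relative to \<open>q\<close>, and
  \<open>lo < hi\<close> rules out that the ratio lies outside on both sides; \<open>q = 0\<close>
  would turn the product into minus a square.\<close>

lemma window_test:
  fixes p q :: int
  assumes "(p - lo * q) * (hi * q - p) > 0"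
  shows "q \<noteq> 0 \<and> of_int lo < real_of_int p / of_int q \<and> real_of_int p / of_int q < of_int hi"
proof -
  have "q \<noteq> 0"
  proof
    assume "q = 0"
    then have "- (p * p) > 0"
      using assms by simp
    then show False
      by (simp add: not_less)
  qed
  have "real_of_int ((p - lo * q) * (hi * q - p)) =
      (real_of_int p / of_int q - of_int lo) * (of_int hi - real_of_int p / of_int q) * (of_int q)\<^sup>2"
    using \<open>q \<noteq> 0\<close> by (simp add: field_simps power2_eq_square)
  then have "(real_of_int p / of_int q - of_int lo) * (of_int hi - real_of_int p / of_int q) * (of_int q)\<^sup>2 > 0"
    using assms of_int_0_less_iff by metis
  then have "(real_of_int p / of_int q - of_int lo) * (of_int hi - real_of_int p / of_int q) > 0"
    using zero_less_mult_pos2 \<open>q \<noteq> 0\<close> by fastforce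
  then show ?thesis
    using \<open>q \<noteq> 0\<close> lo_hi by (auto simp: zero_less_mult_iff)
qed

lemma build_unlinked:
  assumes "\<not> linked M" "has_ratio K (gadget M) a" "a > 0" "c \<le> b"
    and "rooted (insert c {b + K<..b + K + K * (j + 1)}) E c z0 z1" "z0 \<noteq> 0"
  shows "\<exists>y0 y1. rooted (insert c {b<..b + K * (Suc j + 1)}) (emb_edges c b (move_edges K M) @ E) c y0 y1
    \<and> y0 \<noteq> 0 \<and> y1 / y0 = a * (z1 / z0)"
proof -
  \<comment> \<open>Padding to \<open>Suc K\<close> vertices makes the gadget fill the block from
    \<open>b + 1\<close> to \<open>b + K\<close>. A linked gadget keeps \<open>K\<close> vertices,
    since \<open>b + K\<close> is taken by the next root.\<close>
  obtain w where w: "rooted (insert c {b<..<b + Suc K}) (emb_edges c b (gadget M)) c w (a * w)" "w \<noteq> 0"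
    using has_ratio_emb[OF has_ratio_mono[OF assms(2)], of "Suc K" c b] assms(4) by auto
  have "rooted (insert c {b<..<b + Suc K} \<union> insert c {b + K<..b + K + K * (j + 1)})
      (emb_edges c b (gadget M) @ E) c (w * z0) (a * w * z1)"
    by (rule rooted_merge[OF w(1) assms(5)]) (use assms(4) in auto)
  moreover have "insert c {b<..<b + Suc K} \<union> insert c {b + K<..b + K + K * (j + 1)} =
      insert c {b<..b + K * (Suc j + 1)}"
    by (auto simp: algebra_simps)
  ultimately show ?thesis
    using w assms(1,6) by - (rule exI[of _ "w * z0"], rule exI[of _ "a * w * z1"],
      auto simp: move_edges_def)
qed

lemma build_linked:
  assumes "linked M" "has_ratio K (gadget M) a" "c \<le> b"
    and "rooted (insert (b + K) {b + K<..b + K + K * (j + 1)}) E (b + K) z0 z1" "z0 \<noteq> 0"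
    and "\<beta> + z1 / z0 > 0"
  shows "\<exists>y0 y1. rooted (insert c {b<..b + K * (Suc j + 1)}) (emb_edges c b (move_edges K M) @ E) c y0 y1
    \<and> y0 \<noteq> 0 \<and> y1 / y0 = a * edge_map (z1 / z0)"
proof -
  obtain w where w: "rooted (insert c {b<..<b + K}) (emb_edges c b (gadget M)) c w (a * w)" "w \<noteq> 0"
    using has_ratio_emb[OF assms(2,3)] by auto
  let ?V = "insert (b + K) {b + K<..b + K + K * (j + 1)}"
  have "c \<notin> ?V"
    using assms(3) K by auto
  from rooted_extend[OF assms(4) this]
  have "rooted (insert c {b<..<b + K} \<union> insert c ?V) (emb_edges c b (gadget M) @ (c, b + K) # E) c
      (w * (\<beta> * z0 + z1)) (a * w * (z0 + \<gamma> * z1))"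
    by (intro rooted_merge[OF w(1)]) (use assms(3) in auto)
  moreover have "insert c {b<..<b + K} \<union> insert c ?V = insert c {b<..b + K * (Suc j + 1)}"
    using K by (auto simp: algebra_simps)
  moreover have "\<beta> * z0 + z1 = z0 * (\<beta> + z1 / z0)" "z0 + \<gamma> * z1 = z0 * (1 + \<gamma> * (z1 / z0))"
    using assms(5) by (auto simp: field_simps)
  ultimately show ?thesis
    using w assms(1,5,6) K
    by - (rule exI[of _ "w * (\<beta> * z0 + z1)"], rule exI[of _ "a * w * (z0 + \<gamma> * z1)"],
      auto simp: move_edges_def emb_def edge_map_def)
qed

text \<open>\<open>k\<close> bounds the scaling moves still needed. Scaling shifts both logarithms
  equally and keeps the error; every other move halves it. The initial error is at most
  \<open>ln (hi / lo)\<close> because the ratio of \<open>F\<close> and the last target both lie in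
  the window.\<close>

lemma build_correct:
  assumes "q \<noteq> 0" "c \<le> b" "k \<le> j"
    and "of_int lo / 2 ^ k \<le> real_of_int p / of_int q" "real_of_int p / of_int q \<le> of_int hi * 2 ^ k"
  shows "\<exists>z0 z1. rooted (insert c {b<..b + K * (j + 1)}) (build j p q c b) c z0 z1 \<and> z0 \<noteq> 0 \<and> z1 / z0 > 0
    \<and> \<bar>ln (z1 / z0) - ln (real_of_int p / of_int q)\<bar> \<le> ln (of_int hi / of_int lo) / 2 ^ (j - k)"
  using assms
proof (induction j arbitrary: p q c b k)
  case 0
  obtain a where a: "of_int lo \<le> a" "a \<le> of_int hi" "has_ratio K F a"
    using F by blast
  obtain w where w: "rooted (insert c {b<..<b + Suc K}) (emb_edges c b F) c w (a * w)" "w \<noteq> 0"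
    using has_ratio_emb[OF has_ratio_mono[OF a(3)], of "Suc K" c b] 0 by auto
  define x where "x = real_of_int p / of_int q"
  have x: "of_int lo \<le> x" "x \<le> of_int hi"
    using 0 by (auto simp: x_def)
  have a0: "0 < real_of_int lo"
    using lo by simp
  have ln: "ln (of_int lo) \<le> ln a" "ln a \<le> ln (of_int hi)" "ln (of_int lo) \<le> ln x" "ln x \<le> ln (of_int hi)"
    using a x a0 lo_hi by auto
  have "\<bar>ln a - ln x\<bar> \<le> ln (of_int hi / of_int lo)"
    using ln a0 lo_hi by (simp add: ln_div)
  moreover have "{b<..<b + Suc K} = {b<..b + K}"
    by auto
  ultimately show ?case
    using w a a0 0 by - (rule exI[of _ w], rule exI[of _ "a * w"],
      auto simp: x_def)
next
  case (Suc j)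
  define x where "x = real_of_int p / of_int q"
  define M where "M = choose_move p q"
  define p' q' where "p' = new_p M p q" and "q' = new_q M p q"
  define x' where "x' = real_of_int p' / of_int q'"
  have lo0: "0 < real_of_int lo"
    using lo by simp
  have x0: "x > 0"
    using Suc.prems(4) lo0 unfolding x_def[symmetric] by (smt (verit) divide_pos_pos zero_less_power)
  have build: "build (Suc j) p q c b = emb_edges c b (move_edges K M) @
      build j p' q' (if linked M then b + K else c) (b + K)"
    by (simp add: M_def p'_def q'_def)
  \<comment> \<open>Shared by \<open>up\<close> and \<open>dn\<close>: one move and one unit of
    \<open>k\<close> are consumed together, so the exponent \<open>j - k\<close> is
    unchanged.\<close>
  have scale: ?case if M: "\<not> linked M" "has_ratio K (gadget M) a" "a > 0" and q': "q' \<noteq> 0"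
      and x': "x = a * x'" and k: "k = Suc k'" and bd: "of_int lo / 2 ^ k' \<le> x'" "x' \<le> of_int hi * 2 ^ k'"
    for a k'
  proof -
    obtain z0 z1 where z: "rooted (insert c {b + K<..b + K + K * (j + 1)}) (build j p' q' c (b + K)) c z0 z1"
        "z0 \<noteq> 0" "z1 / z0 > 0" "\<bar>ln (z1 / z0) - ln x'\<bar> \<le> ln (of_int hi / of_int lo) / 2 ^ (j - k')"
      using Suc.IH[of q' c "b + K" k' p'] q' bd Suc.prems k by (auto simp: x'_def)
    obtain y0 y1 where y: "rooted (insert c {b<..b + K * (Suc j + 1)}) (build (Suc j) p q c b) c y0 y1"
        "y0 \<noteq> 0" "y1 / y0 = a * (z1 / z0)"
      using build_unlinked[OF M Suc.prems(2) z(1,2)] M(1) unfolding build by auto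
    have "x' > 0"
      using x' x0 M(3) by (simp add: zero_less_mult_iff)
    then have "ln (y1 / y0) - ln x = ln (z1 / z0) - ln x'"
      using ln_mult_pos[OF M(3) z(3)] ln_mult_pos[OF M(3)] unfolding y(3) x' by simp
    then have "\<bar>ln (y1 / y0) - ln x\<bar> \<le> ln (of_int hi / of_int lo) / 2 ^ (Suc j - k)"
      using z(4) k by simp
    moreover have "y1 / y0 > 0"
      unfolding y(3) using z(3) M(3) by (rule mult_pos_pos[rotated])
    ultimately show ?thesis
      using y(1,2) unfolding x_def[symmetric] by blast
  qed
  consider (up) "x > of_int hi" | (dn) "x < of_int lo" | (mid) "of_int lo \<le> x" "x \<le> of_int hi"
    by linarith
  then show ?case
  proof cases
    case up
    have M: "M = up"
      using up guard_iff(1)[OF Suc.prems(1), of p hi] by (simp add: M_def choose_move_def x_def)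
    obtain a where a: "2 \<le> a" "a \<le> of_int hi / of_int lo" "has_ratio K (gadget up) a"
      "q' \<noteq> 0" "x = a * x'"
      using approximation_scheme.up(2)[OF approximation_scheme_axioms] Suc.prems(1)
      unfolding p'_def q'_def x_def x'_def M by blast
    \<comment> \<open>With \<open>k\<close> = 0 the target would already lie in the window.\<close>
    obtain k' where k': "k = Suc k'"
      using up Suc.prems(5) by (cases k) (auto simp: x_def)
    \<comment> \<open>Dividing by \<open>a\<close> at least halves the excess over the window since
      \<open>a\<close> is at least 2, and does not overshoot it since \<open>a\<close> is at most
      \<open>hi / lo\<close>. The case \<open>dn\<close> mirrors this.\<close>
    have x': "x' = x / a"
      using a by simp
    have "x' \<le> of_int hi * 2 ^ k'"
    proof -
      have "x / a \<le> x / 2"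
        using a x0 by (intro divide_left_mono) auto
      then show ?thesis
        using Suc.prems(5) unfolding x' x_def[symmetric] k' power_Suc by linarith
    qed
    moreover have "of_int lo / 2 ^ k' \<le> x'"
    proof -
      have "of_int lo / 2 ^ k' \<le> real_of_int lo"
        using lo0 by (simp add: field_simps)
      also have "of_int lo * a \<le> x"
        using a(2) up lo0 by (simp add: field_simps)
      then have "real_of_int lo \<le> x'"
        using a(1) by (simp add: x' field_simps)
      finally show ?thesis .
    qed
    moreover have "\<not> linked M"
      using approximation_scheme.up(1)[OF approximation_scheme_axioms] by (simp add: M)
    ultimately show ?thesis
      using scale[of a k'] a k' by (simp add: M)
  next
    case dn
    have M: "M = dn"
      using dn lo_hi guard_iff(1)[OF Suc.prems(1), of p hi]
        guard_iff(2)[OF Suc.prems(1), of lo p] by (simp add: M_def choose_move_def x_def)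
    obtain a where a: "of_int lo / of_int hi \<le> a" "0 < a" "a \<le> 1 / 2" "has_ratio K (gadget dn) a"
      "q' \<noteq> 0" "x = a * x'"
      using approximation_scheme.dn(2)[OF approximation_scheme_axioms] Suc.prems(1)
      unfolding p'_def q'_def x_def x'_def M by blast
    obtain k' where k': "k = Suc k'"
      using dn Suc.prems(4) by (cases k) (auto simp: x_def)
    have x': "x' = x / a"
      using a by simp
    have "of_int lo / 2 ^ k' \<le> x'"
    proof -
      have "real_of_int lo / 2 ^ k' = 2 * (of_int lo / 2 ^ Suc k')"
        by simp
      also have "\<dots> \<le> 2 * x"
        using Suc.prems(4) unfolding x_def[symmetric] k' by (intro mult_left_mono) auto
      also have "x / (1 / 2) \<le> x / a"
        using a x0 by (intro divide_left_mono) auto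
      then have "2 * x \<le> x'"
        by (simp add: x')
      finally show ?thesis .
    qed
    moreover have "x' \<le> of_int hi * 2 ^ k'"
    proof -
      have "real_of_int lo \<le> a * of_int hi"
        using a(1) lo lo_hi by (simp add: field_simps)
      then have "x' \<le> of_int hi"
        using a(2) dn by (simp add: x' field_simps)
      also have "real_of_int hi \<le> of_int hi * 2 ^ k'"
        using lo lo_hi by simp
      finally show ?thesis .
    qed
    moreover have "\<not> linked M"
      using approximation_scheme.dn(1)[OF approximation_scheme_axioms] by (simp add: M)
    ultimately show ?thesis
      using scale[of a k'] a k' by (simp add: M)
  next
    case mid
    have M: "M = pick Ms p q"
      using mid guard_iff(1)[OF Suc.prems(1), of p hi]
        guard_iff(2)[OF Suc.prems(1), of lo p] by (simp add: M_def choose_move_def x_def)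
    have "M \<in> set Ms" "(p' - lo * q') * (hi * q' - p') > 0"
      using pick_test[OF cover[OF Suc.prems(1)]] mid unfolding M p'_def q'_def x_def by auto
    then have q': "q' \<noteq> 0" and x': "of_int lo < x'" "x' < of_int hi"
      using window_test unfolding x'_def by auto
    obtain a where a: "a < 0" "has_ratio K (gadget M) a" "x = a * edge_map x'" "linked M"
      using Ms[OF \<open>M \<in> set Ms\<close>] Suc.prems(1) q' x' unfolding x'_def x_def p'_def q'_def by blast
    \<comment> \<open>The pulled-back target is again in the window, so the induction hypothesis
      applies with 0 scaling moves and its full exponent.\<close>
    obtain z0 z1 where z: "rooted (insert (b + K) {b + K<..b + K + K * (j + 1)})
          (build j p' q' (b + K) (b + K)) (b + K) z0 z1"
        "z0 \<noteq> 0" "z1 / z0 > 0" "\<bar>ln (z1 / z0) - ln x'\<bar> \<le> ln (of_int hi / of_int lo) / 2 ^ j"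
      using Suc.IH[of q' "b + K" "b + K" 0 p'] q' x' by (auto simp: x'_def)
    define r where "r = z1 / z0"
    have hl: "ln (real_of_int hi / of_int lo) > 0"
      using lo lo_hi by simp
    have "ln (of_int hi / of_int lo) / 2 ^ j \<le> ln (real_of_int hi / of_int lo)"
      using hl by (simp add: divide_le_eq)
    then have "ln x' - ln r \<le> ln (of_int hi / of_int lo)"
      using z(4) by (simp add: r_def)
    then have "ln (x' * of_int lo / of_int hi) \<le> ln r"
      using lo lo_hi x' by (simp add: ln_div ln_mult)
    then have "x' * of_int lo / of_int hi \<le> r"
      using z(3) x' lo lo_hi by (simp add: r_def)
    moreover have "real_of_int lo * of_int lo / of_int hi \<le> x' * of_int lo / of_int hi"
      using x' lo lo_hi by (intro divide_right_mono mult_right_mono) auto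
    ultimately have r: "of_int (lo\<^sup>2) / of_int hi \<le> r"
      by (simp add: power2_eq_square)
    have "real_of_int lo * of_int lo / of_int hi \<le> of_int lo"
      using lo lo_hi by (simp add: field_simps)
    then have x'r: "of_int (lo\<^sup>2) / of_int hi \<le> x'"
      using x' by (simp add: power2_eq_square)
    obtain y0 y1 where y: "rooted (insert c {b<..b + K * (Suc j + 1)}) (build (Suc j) p q c b) c y0 y1"
        "y0 \<noteq> 0" "y1 / y0 = a * edge_map r"
      using build_linked[OF a(4,2) Suc.prems(2) z(1,2)] contr_pos[OF r] a(4) unfolding build r_def by auto
    have "ln (a * edge_map s) = ln (- a) + ln (- edge_map s)" if "edge_map s < 0" for s
      using ln_mult[of "- a" "- edge_map s"] a(1) that by simp
    then have "\<bar>ln (y1 / y0) - ln x\<bar> = \<bar>ln (- edge_map r) - ln (- edge_map x')\<bar>"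
      unfolding y(3) a(3) using contr_pos[OF r] contr_pos[OF x'r] by simp
    also have "\<dots> \<le> \<bar>ln r - ln x'\<bar> / 2"
      by (rule contr[OF r x'r])
    also have "\<dots> \<le> ln (of_int hi / of_int lo) / 2 ^ Suc j"
      using z(4) by (simp add: r_def)
    also have "\<dots> \<le> ln (of_int hi / of_int lo) / 2 ^ (Suc j - k)"
      using hl by (intro divide_left_mono power_increasing) auto
    finally have "\<bar>ln (y1 / y0) - ln x\<bar> \<le> ln (of_int hi / of_int lo) / 2 ^ (Suc j - k)" .
    moreover have "y1 / y0 > 0"
      unfolding y(3) using a(1) contr_pos[OF r] by (simp add: mult_neg_neg)
    ultimately show ?thesis
      using y unfolding x_def[symmetric] by blast
  qed
qed

end

section \<open>Integer matrices for the inverse branches\<close>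

context two_spin
begin

lemma implementable_Rats:
  assumes "implementable a" "\<beta> \<in> \<rat>" "\<gamma> \<in> \<rat>"
  shows "a \<in> \<rat>"
  using assms rooted_Rats unfolding implementable_def realizable_def by (metis Rats_divide)

text \<open>The integer matrix \<open>(-B j, d i; d j, -G i)\<close>, where \<open>\<beta> = B / d\<close>, \<open>\<gamma> = G / d\<close> and \<open>a = i / j\<close>,
  represents the inverse of \<open>\<lambda>t. a * edge_map t\<close>.\<close>

lemma edge_map_inverse:
  fixes p q d B G i j :: real
  defines "p' \<equiv> - (B * j) * p + d * i * q" and "q' \<equiv> d * j * p + - (G * i) * q"
  assumes "\<beta> = B / d" "\<gamma> = G / d" "d \<noteq> 0" "i \<noteq> 0" "j \<noteq> 0" "q \<noteq> 0" "q' \<noteq> 0" "\<beta> + p' / q' \<noteq> 0"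
  shows "p / q = i / j * edge_map (p' / q')"
proof -
  \<comment> \<open>The two integer matrices are inverse up to a scalar; \<Delta> is the square of
    \<open>d\<close> times 1 - \<beta> \<gamma> and cancels from the ratio.\<close>
  define \<Delta> where "\<Delta> = d * d - B * G"
  have num: "1 + \<gamma> * (p' / q') = (d * q' + G * p') / (d * q')"
    and den: "\<beta> + p' / q' = (B * q' + d * p') / (d * q')"
    using assms by (auto simp: field_simps)
  have n: "d * q' + G * p' = j * p * \<Delta>" and m: "B * q' + d * p' = i * q * \<Delta>"
    by (auto simp: p'_def q'_def \<Delta>_def algebra_simps)
  have "\<Delta> \<noteq> 0"
    using \<open>\<beta> + p' / q' \<noteq> 0\<close> unfolding den m by auto
  then have "edge_map (p' / q') = j * p / (i * q)"
    unfolding edge_map_def num den n m using assms(5-9) by simp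
  then show ?thesis
    using assms(6,7) by simp
qed

text \<open>The converse direction, for \<open>cover\<close>: a preimage known to exist is the one
  the matrix computes. The new denominator is nonzero because \<open>edge_map\<close> does not
  attain \<gamma>, its value at infinity.\<close>

lemma edge_map_inverse_unique:
  fixes p q d B G i j t :: real
  defines "p' \<equiv> - (B * j) * p + d * i * q" and "q' \<equiv> d * j * p + - (G * i) * q"
  assumes "\<beta> = B / d" "\<gamma> = G / d" "d \<noteq> 0" "i \<noteq> 0" "j \<noteq> 0" "q \<noteq> 0"
    and "p / q = i / j * edge_map t" "\<beta> + t \<noteq> 0" "\<beta> * \<gamma> \<noteq> 1"
  shows "p' = t * q'" "q' \<noteq> 0"
proof -
  define y where "y = edge_map t"
  have jp: "j * p = i * q * y"
    using assms(5-9) by (simp add: y_def field_simps)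
  have B: "B = \<beta> * d" and G: "G = \<gamma> * d"
    using assms by auto
  have q': "q' = d * (i * q) * (y - \<gamma>)"
    using jp by (simp add: q'_def G algebra_simps)
  have p': "p' = d * (i * q) * (1 - \<beta> * y)"
    using jp by (simp add: p'_def B algebra_simps)
  have y: "y - \<gamma> = (1 - \<beta> * \<gamma>) / (\<beta> + t)"
    using edge_map_alt[OF \<open>\<beta> + t \<noteq> 0\<close>] by (simp add: y_def)
  have "y * (\<beta> + t) = 1 + \<gamma> * t"
    using \<open>\<beta> + t \<noteq> 0\<close> by (simp add: y_def edge_map_def)
  then have "1 - \<beta> * y = t * (y - \<gamma>)"
    by (simp add: algebra_simps)
  then show "p' = t * q'"
    by (simp add: p' q')
  show "q' \<noteq> 0"
    unfolding q' y using assms(5-11) by simp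
qed

end

lemma Rats_common_denominator:
  fixes x y :: real
  assumes "x \<in> \<rat>" "y \<in> \<rat>"
  obtains B G d :: int where "d \<noteq> 0" "x = of_int B / of_int d" "y = of_int G / of_int d"
proof -
  obtain a b where ab: "x = of_int a / of_int b" "b \<noteq> 0"
    using assms(1) by (auto simp: Rats_eq_int_div_int)
  obtain c e where ce: "y = of_int c / of_int e" "e \<noteq> 0"
    using assms(2) by (auto simp: Rats_eq_int_div_int)
  show ?thesis
    by (rule that[of "b * e" "a * e" "c * b"]) (use ab ce in auto)
qed

lemma (in spin_region) approximation_scheme_exists:
  assumes rat: "\<beta> \<in> \<rat>" "\<gamma> \<in> \<rat>"
  shows "\<exists>K lo hi up dn Ms F \<mu>. approximation_scheme \<beta> \<gamma> K lo hi up dn Ms F \<mu>"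
proof -
  obtain \<rho> where \<rho>: "\<rho> > 0" "\<And>r. r \<ge> \<rho> \<Longrightarrow> \<beta> + r > 0" "\<And>r. r \<ge> \<rho> \<Longrightarrow> edge_map r < 0"
    "\<And>r s. r \<ge> \<rho> \<Longrightarrow> s \<ge> \<rho> \<Longrightarrow>
      \<bar>ln (- edge_map r) - ln (- edge_map s)\<bar> \<le> \<bar>ln r - ln s\<bar> / 2"
    using edge_map_contraction by blast
  define m where "m = \<lceil>\<rho>\<rceil>"
  have m: "m > 0" "of_int m \<ge> \<rho>"
    using \<rho>(1) by (auto simp: m_def)
  \<comment> \<open>\<open>hi / lo\<close> = 3 leaves room for scaling factors between 2 and 3 and
    between 1/3 and 1/2, while \<open>lo\<^sup>2 / hi\<close> = \<open>m\<close> stays in the range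
    of contraction.\<close>
  define lo hi where "lo = 3 * m" and "hi = 9 * m"
  have lh: "0 < lo" "lo < hi" "real_of_int (lo\<^sup>2) / of_int hi = of_int m" "real_of_int hi / of_int lo = 3"
    "real_of_int lo / of_int hi = 1 / 3"
    using m by (auto simp: lo_def hi_def power2_eq_square)
  have lo\<rho>: "of_int lo \<ge> \<rho>"
    using m by (simp add: lo_def)
  obtain a1 where a1: "implementable a1" "2 < a1" "a1 < 3"
    using implementable_pos_dense[of 2 3] by auto
  obtain a2 where a2: "implementable a2" "1 / 3 < a2" "a2 < 1 / 2"
    using implementable_pos_dense[of "1 / 3" "1 / 2"] by auto
  obtain a3 where a3: "implementable a3" "of_int lo < a3" "a3 < of_int hi"
    using implementable_pos_dense[of "of_int lo" "of_int hi"] lh by auto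
  have l: "0 < real_of_int lo" "real_of_int lo < of_int hi"
    and lr: "\<And>r. r \<ge> of_int lo \<Longrightarrow> \<beta> + r > 0" "\<And>r. r \<ge> of_int lo \<Longrightarrow> edge_map r < 0"
    using lh(1,2) \<rho>(2,3) order_trans[OF lo\<rho>] by auto
  obtain S where S: "finite S" "\<And>a. a \<in> S \<Longrightarrow> implementable a \<and> a < 0"
    "\<And>x. of_int lo \<le> x \<Longrightarrow> x \<le> of_int hi \<Longrightarrow>
      \<exists>a\<in>S. \<exists>t. of_int lo < t \<and> t < of_int hi \<and> x = a * edge_map t"
    by (rule edge_map_cover[OF l lr]) (assumption, assumption, rule that)
  obtain k D where kD: "\<And>a. implementable a \<Longrightarrow> has_ratio (k a) (D a) a"
    using implementable_has_ratio by metis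
  \<comment> \<open>The sum dominates every single gadget size; \<open>Suc\<close> makes it
    positive.\<close>
  define K where "K = Suc (sum k ({a1, a2, a3} \<union> S))"
  have "has_ratio K (D a) a" if "a \<in> {a1, a2, a3} \<union> S" for a
  proof (rule has_ratio_mono[OF kD])
    show "implementable a"
      using that a1 a2 a3 S by auto
    show "k a \<le> K"
      using member_le_sum[OF that, of k] S(1) by (simp add: K_def)
  qed
  then have ratio: "has_ratio K (D a1) a1" "has_ratio K (D a2) a2" "has_ratio K (D a3) a3"
    "\<And>a. a \<in> S \<Longrightarrow> has_ratio K (D a) a"
    by auto
  have "\<exists>i j. j \<noteq> 0 \<and> a = real_of_int i / of_int j" if "implementable a" for a
    using implementable_Rats[OF that rat] unfolding Rats_eq_int_div_int by blast
  then obtain i j where ij: "\<And>a. implementable a \<Longrightarrow> j a \<noteq> 0 \<and> a = real_of_int (i a) / of_int (j a)"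
    by metis
  have i0: "i a \<noteq> 0" if "implementable a" "a \<noteq> 0" for a
    using ij[OF that(1)] that(2) by auto
  obtain B G d :: int where d: "d \<noteq> 0" "\<beta> = of_int B / of_int d" "\<gamma> = of_int G / of_int d"
    using Rats_common_denominator[OF rat] by metis
  \<comment> \<open>With \<open>a = i / j\<close>, dividing p/q by \<open>a\<close> gives (j p)/(i
    q), left unreduced; \<open>link\<close> uses the matrix of
    \<open>edge_map_inverse\<close>.\<close>
  define scale where "scale a = Move False (D a) (j a) 0 0 (i a)" for a
  define link where "link a = Move True (D a) (- (B * j a)) (d * i a) (d * j a) (- (G * i a))" for a
  have scale: "new_q (scale a) p q \<noteq> 0 \<and>
      real_of_int p / of_int q = a * (of_int (new_p (scale a) p q) / of_int (new_q (scale a) p q))"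
    if "implementable a" "a \<noteq> 0" "q \<noteq> 0" for a p q
  proof -
    have "real_of_int (i a) / of_int (j a) * (of_int (j a * p) / of_int (i a * q)) = of_int p / of_int q"
      using ij[OF that(1), THEN conjunct1] i0[OF that(1,2)] that(3) by simp
    then have "real_of_int p / of_int q = a * (of_int (j a * p) / of_int (i a * q))"
      unfolding ij[OF that(1), THEN conjunct2, symmetric] by (rule sym)
    then show ?thesis
      using i0[OF that(1,2)] that(3) by (simp add: new_p_def new_q_def scale_def)
  qed
  have P: "real_of_int (new_p (link a) p q) =
      - (of_int B * of_int (j a)) * of_int p + of_int d * of_int (i a) * of_int q"
    and Q: "real_of_int (new_q (link a) p q) =
      of_int d * of_int (j a) * of_int p + - (of_int G * of_int (i a)) * of_int q" for a p q
    by (simp_all add: new_p_def new_q_def link_def)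
  have link: "real_of_int p / of_int q = a * edge_map (of_int (new_p (link a) p q) / of_int (new_q (link a) p q))"
    if a: "a \<in> S" and q: "q \<noteq> 0" "new_q (link a) p q \<noteq> 0"
      and x: "of_int (new_p (link a) p q) / of_int (new_q (link a) p q) > real_of_int lo" for a p q
  proof -
    have ia: "implementable a" "a \<noteq> 0"
      using S(2)[OF a] by auto
    have nz: "real_of_int d \<noteq> 0" "real_of_int (i a) \<noteq> 0" "real_of_int (j a) \<noteq> 0" "real_of_int q \<noteq> 0"
      using d(1) ij[OF ia(1), THEN conjunct1] i0[OF ia] q(1) by simp_all
    have "\<beta> + of_int (new_p (link a) p q) / of_int (new_q (link a) p q) > 0"
      using x lo\<rho> by (intro \<rho>(2)) simp
    moreover have "real_of_int (new_q (link a) p q) \<noteq> 0"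
      using q(2) by simp
    ultimately have "real_of_int p / of_int q = real_of_int (i a) / of_int (j a) *
        edge_map (of_int (new_p (link a) p q) / of_int (new_q (link a) p q))"
      unfolding P Q by (intro edge_map_inverse[OF d(2,3) nz(1-3)] nz(4)) simp_all
    then show ?thesis
      unfolding ij[OF ia(1), THEN conjunct2, symmetric] .
  qed
  obtain xs where xs: "set xs = S"
    using finite_list[OF S(1)] by blast
  define Ms where "Ms = map link xs"
  have cover: "\<exists>M\<in>set Ms. (new_p M p q - lo * new_q M p q) * (hi * new_q M p q - new_p M p q) > 0"
    if q: "q \<noteq> 0" and x: "real_of_int lo \<le> of_int p / of_int q" "of_int p / of_int q \<le> real_of_int hi" for p q
  proof -
    obtain a t where at: "a \<in> S" "of_int lo < t" "t < of_int hi" "real_of_int p / of_int q = a * edge_map t"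
      using S(3)[OF x] by blast
    have ia: "implementable a" "a \<noteq> 0"
      using S(2)[OF at(1)] by auto
    have t: "\<beta> + t > 0"
      using at(2) lo\<rho> by (intro \<rho>(2)) simp
    define p' q' where "p' = new_p (link a) p q" and "q' = new_q (link a) p q"
    have at': "real_of_int p / of_int q = real_of_int (i a) / of_int (j a) * edge_map t"
      using at(4) unfolding ij[OF ia(1), THEN conjunct2, symmetric] .
    have nz: "real_of_int d \<noteq> 0" "real_of_int (i a) \<noteq> 0" "real_of_int (j a) \<noteq> 0" "real_of_int q \<noteq> 0"
      "\<beta> + t \<noteq> 0" "\<beta> * \<gamma> \<noteq> 1"
      using d(1) ij[OF ia(1), THEN conjunct1] i0[OF ia] q t det_pos by simp_all
    have "real_of_int p' = t * of_int q'" "real_of_int q' \<noteq> 0"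
      unfolding p'_def q'_def P Q by (rule edge_map_inverse_unique[OF d(2,3) nz(1-4) at' nz(5,6)])+
    then have "real_of_int ((p' - lo * q') * (hi * q' - p')) = (t - of_int lo) * (of_int hi - t) * (of_int q')\<^sup>2"
      by (simp add: algebra_simps power2_eq_square)
    also have "\<dots> > 0"
      using at \<open>real_of_int q' \<noteq> 0\<close> by simp
    finally have "(p' - lo * q') * (hi * q' - p') > 0"
      using of_int_0_less_iff by blast
    then show ?thesis
      using at(1) xs by (auto simp: Ms_def p'_def q'_def)
  qed
  define w where "w M = nat (\<bar>m11 M\<bar> + \<bar>m12 M\<bar> + \<bar>m21 M\<bar> + \<bar>m22 M\<bar>)" for M
  \<comment> \<open>A crude bound: the sum of the absolute values of all entries, turned into an
    exponent because a number is below its power of two.\<close>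
  define \<mu> where "\<mu> = sum_list (map w (scale a1 # scale a2 # Ms))"
  have \<mu>: "\<bar>m11 M\<bar> + \<bar>m12 M\<bar> \<le> 2 ^ \<mu> \<and> \<bar>m21 M\<bar> + \<bar>m22 M\<bar> \<le> 2 ^ \<mu>"
    if "M \<in> set (scale a1 # scale a2 # Ms)" for M
  proof -
    have "w M \<le> \<mu>"
      unfolding \<mu>_def using that by (intro member_le_sum_list) auto
    then have "int (w M) \<le> int \<mu>"
      by simp
    also have "int \<mu> < 2 ^ \<mu>"
      by (rule of_nat_less_two_power)
    finally show ?thesis
      by (auto simp: w_def)
  qed
  have "approximation_scheme \<beta> \<gamma> K lo hi (scale a1) (scale a2) Ms (D a3) \<mu>"
  proof (unfold_locales, goal_cases)
    case 1
    then show ?case by (simp add: K_def)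
  next
    case 6
    then show ?case by (simp add: scale_def)
  next
    case 7
    show ?case
    proof (intro exI[of _ a1] conjI allI impI)
      show "new_q (scale a1) p q \<noteq> 0" "real_of_int p / of_int q =
          a1 * (of_int (new_p (scale a1) p q) / of_int (new_q (scale a1) p q))" if "q \<noteq> 0" for p q
        using scale[of a1 q p] a1 that by auto
    qed (use a1 ratio(1) lh(4) in \<open>auto simp: scale_def\<close>)
  next
    case 8
    then show ?case by (simp add: scale_def)
  next
    case 9
    show ?case
    proof (intro exI[of _ a2] conjI allI impI)
      show "new_q (scale a2) p q \<noteq> 0" "real_of_int p / of_int q =
          a2 * (of_int (new_p (scale a2) p q) / of_int (new_q (scale a2) p q))" if "q \<noteq> 0" for p q
        using scale[of a2 q p] a2 that by auto
    qed (use a2 ratio(2) lh(5) in \<open>auto simp: scale_def\<close>)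
  next
    case (10 M)
    then obtain a where a: "a \<in> S" "M = link a"
      using xs by (auto simp: Ms_def)
    then show ?case
      using S(2)[OF a(1)] ratio(4)[OF a(1)] link[OF a(1)] by (auto simp: link_def intro!: exI[of _ a])
  next
    case (11 q p)
    then show ?case by (rule cover)
  next
    case 12
    show ?case
      using a3 ratio(3) by (intro exI[of _ a3]) auto
  next
    case (13 M)
    then show ?case by (rule \<mu>)
  qed (use lh m \<rho> in auto)
  then show ?thesis
    by blast
qed

section \<open>Running times of loop-free programs and loops\<close>

lemma bits_le_iff: "bits n \<le> Suc k \<longleftrightarrow> \<bar>n\<bar> < 2 ^ k"
  by (simp add: bits_def nat_le_iff bitlen_le_iff_power)

lemma bits_pos: "bits n > 0"
  by (simp add: bits_def)

lemma abs_less_two_power_bits: "\<bar>n\<bar> < 2 ^ (bits n - 1)"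
  using bits_le_iff[of n "bits n - 1"] bits_pos[of n] by simp

lemma bits_mono: "\<bar>a\<bar> \<le> \<bar>b\<bar> \<Longrightarrow> bits a \<le> bits b"
  using bits_le_iff[of a "bits b - 1"] bits_pos[of b] abs_less_two_power_bits[of b] by simp

lemma bits_le_abs: "bits n \<le> nat \<bar>n\<bar> + 1"
proof -
  have "\<bar>n\<bar> < 2 ^ nat \<bar>n\<bar>"
    using of_nat_less_two_power[of "nat \<bar>n\<bar>", where 'a = int] by simp
  then show ?thesis
    using bits_le_iff by simp
qed

lemma bits_mult: "bits (a * b) \<le> bits a + bits b"
proof -
  have "\<bar>a * b\<bar> < 2 ^ ((bits a - 1) + (bits b - 1))"
    unfolding abs_mult power_add
    by (intro mult_strict_mono' abs_less_two_power_bits) auto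
  then have "bits (a * b) \<le> Suc ((bits a - 1) + (bits b - 1))"
    by (simp only: bits_le_iff)
  then show ?thesis
    using bits_pos[of a] by linarith
qed

lemma two_power_sum_le: "2 ^ i + 2 ^ j \<le> (2 ^ (i + j + 1) :: int)"
proof -
  have "(2 :: int) ^ i \<le> 2 ^ (i + j)" "(2 :: int) ^ j \<le> 2 ^ (i + j)"
    by (auto intro: power_increasing)
  then have "(2 :: int) ^ i + 2 ^ j \<le> 2 * 2 ^ (i + j)"
    by linarith
  then show ?thesis
    by simp
qed

lemma bits_add: "bits (a + b) \<le> bits a + bits b"
proof -
  have "\<bar>a + b\<bar> \<le> \<bar>a\<bar> + \<bar>b\<bar>"
    by simp
  also have "\<dots> < 2 ^ (bits a - 1) + 2 ^ (bits b - 1)"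
    by (intro add_strict_mono abs_less_two_power_bits)
  also have "\<dots> \<le> 2 ^ ((bits a - 1) + (bits b - 1) + 1)"
    by (rule two_power_sum_le)
  finally have "bits (a + b) \<le> Suc ((bits a - 1) + (bits b - 1) + 1)"
    by (simp only: bits_le_iff)
  then show ?thesis
    using bits_pos[of a] bits_pos[of b] by linarith
qed

lemma bits_diff: "bits (a - b) \<le> bits a + bits b"
  using bits_add[of a "- b"] by (simp add: bits_def)

text \<open>\<open>div\<close> rounds down, hence away from zero for negative quotients. A remainder
  smaller than |b| still leaves no room for a quotient of size |a| + 1.\<close>

lemma abs_div_le: "\<bar>a div b\<bar> \<le> \<bar>a :: int\<bar>"
proof (cases "b = 0")
  case False
  have "\<bar>b\<bar> * \<bar>a div b\<bar> = \<bar>a - a mod b\<bar>"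
    by (simp add: abs_mult[symmetric] minus_mod_eq_mult_div)
  show ?thesis
  proof (rule ccontr)
    assume "\<not> ?thesis"
    then have "\<bar>a div b\<bar> \<ge> \<bar>a\<bar> + 1"
      by simp
    moreover have "\<bar>a mod b\<bar> < \<bar>b\<bar>"
      using False by (simp add: abs_mod_less)
    moreover have "\<bar>b\<bar> * (\<bar>a\<bar> + 1) \<le> \<bar>b\<bar> * \<bar>a div b\<bar>"
      using calculation(1) by (intro mult_left_mono) auto
    moreover have "\<bar>a\<bar> \<le> \<bar>b\<bar> * \<bar>a\<bar>"
      using False mult_right_mono[of 1 "\<bar>b\<bar>" "\<bar>a\<bar>"] by simp
    moreover have "\<bar>a - a mod b\<bar> \<le> \<bar>a\<bar> + \<bar>a mod b\<bar>"
      by simp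
    ultimately show False
      using \<open>\<bar>b\<bar> * \<bar>a div b\<bar> = \<bar>a - a mod b\<bar>\<close> unfolding distrib_left by linarith
  qed
qed simp

lemma bits_div: "bits (a div b) \<le> bits a"
  by (intro bits_mono abs_div_le)

text \<open>\<open>expr_growth\<close> and \<open>expr_factor\<close> depend on the syntax alone. If
  all registers have at most \<open>B\<close> bits, values have O(B) bits, and the cost is quadratic
  in \<open>B\<close> because of schoolbook multiplication and division.\<close>

fun expr_growth :: "aexp \<Rightarrow> nat" where
  "expr_growth (Const n) = bits n"
| "expr_growth (Reg r) = 1"
| "expr_growth (Add a b) = expr_growth a + expr_growth b"
| "expr_growth (Sub a b) = expr_growth a + expr_growth b"
| "expr_growth (Mul a b) = expr_growth a + expr_growth b"
| "expr_growth (Div a b) = expr_growth a"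

fun expr_factor :: "aexp \<Rightarrow> nat" where
  "expr_factor (Const n) = bits n"
| "expr_factor (Reg r) = 1"
| "expr_factor (Add a b) = expr_factor a + expr_factor b + expr_growth a + expr_growth b"
| "expr_factor (Sub a b) = expr_factor a + expr_factor b + expr_growth a + expr_growth b"
| "expr_factor (Mul a b) = expr_factor a + expr_factor b + expr_growth a * expr_growth b"
| "expr_factor (Div a b) = expr_factor a + expr_factor b + expr_growth a * expr_growth b"

definition fits :: "nat \<Rightarrow> (nat \<Rightarrow> int) \<Rightarrow> bool" where
  "fits B s \<longleftrightarrow> (\<forall>r. bits (s r) \<le> B)"

lemma fits_pos: "fits B s \<Longrightarrow> B > 0"
  using bits_pos[of "s 0"] unfolding fits_def by (metis gr_zeroI not_le)

lemma bits_aval: "fits B s \<Longrightarrow> bits (aval e s) \<le> expr_growth e * B"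
proof (induction e)
  case (Const n)
  then show ?case
    using fits_pos[of B s] by simp
next
  case (Reg r)
  then show ?case
    by (simp add: fits_def)
next
  case (Add a b)
  then show ?case
    using bits_add[of "aval a s" "aval b s"] by (simp add: distrib_right)
next
  case (Sub a b)
  then show ?case
    using bits_diff[of "aval a s" "aval b s"] by (simp add: distrib_right)
next
  case (Mul a b)
  then show ?case
    using bits_mult[of "aval a s" "aval b s"] by (simp add: distrib_right)
next
  case (Div a b)
  then show ?case
    using bits_div[of "aval a s" "aval b s"] by simp
qed

lemma acost_le: "fits B s \<Longrightarrow> acost e s \<le> expr_factor e * B\<^sup>2"
proof (induction e)
  case (Const n)
  then show ?case
    using fits_pos[of B s] by simp
next
  case (Reg r)
  have "B \<le> B\<^sup>2"
    using fits_pos[OF Reg] by (simp add: power2_eq_square)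
  moreover have "bits (s r) \<le> B"
    using Reg by (simp add: fits_def)
  ultimately show ?case
    by simp
next
  case (Add a b)
  have "expr_growth e * B \<le> expr_growth e * B\<^sup>2" for e
    using fits_pos[OF Add.prems] by (simp add: power2_eq_square)
  then show ?case
    using Add bits_aval[OF Add.prems, of a] bits_aval[OF Add.prems, of b]
    by (simp add: distrib_right add_mono le_trans)
next
  case (Sub a b)
  have "expr_growth e * B \<le> expr_growth e * B\<^sup>2" for e
    using fits_pos[OF Sub.prems] by (simp add: power2_eq_square)
  then show ?case
    using Sub bits_aval[OF Sub.prems, of a] bits_aval[OF Sub.prems, of b]
    by (simp add: distrib_right add_mono le_trans)
next
  case (Mul a b)
  then show ?case
    using mult_mono[OF bits_aval[OF Mul.prems, of a] bits_aval[OF Mul.prems, of b]]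
    by (simp add: algebra_simps power2_eq_square)
next
  case (Div a b)
  then show ?case
    using mult_mono[OF bits_aval[OF Div.prems, of a] bits_aval[OF Div.prems, of b]]
    by (simp add: algebra_simps power2_eq_square)
qed

fun loop_free :: "com \<Rightarrow> bool" where
  "loop_free (Seq c d) \<longleftrightarrow> loop_free c \<and> loop_free d"
| "loop_free (Cond b c d) \<longleftrightarrow> loop_free c \<and> loop_free d"
| "loop_free (While b c) \<longleftrightarrow> False"
| "loop_free _ \<longleftrightarrow> True"

fun run :: "com \<Rightarrow> config \<Rightarrow> config" where
  "run (Assign r a) \<sigma> = ((fst \<sigma>)(r := aval a (fst \<sigma>)), snd \<sigma>)"
| "run (Emit a) \<sigma> = (fst \<sigma>, snd \<sigma> @ [aval a (fst \<sigma>)])"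
| "run (Seq c d) \<sigma> = run d (run c \<sigma>)"
| "run (Cond b c d) \<sigma> = (if aval b (fst \<sigma>) > 0 then run c \<sigma> else run d \<sigma>)"
| "run _ \<sigma> = \<sigma>"

fun com_growth :: "com \<Rightarrow> nat" where
  "com_growth (Assign r a) = expr_growth a + 1"
| "com_growth (Seq c d) = com_growth d * com_growth c"
| "com_growth (Cond b c d) = com_growth c + com_growth d"
| "com_growth _ = 1"

text \<open>In a sequence the second program starts with registers of up to
  \<open>com_growth c * B\<close> bits, which enter squared. Only loop-free programs are meant;
  loops are treated in \<open>exec_While\<close>.\<close>

fun com_factor :: "com \<Rightarrow> nat" where
  "com_factor Skip = 1"
| "com_factor (Assign r a) = expr_factor a + 1"
| "com_factor (Emit a) = expr_factor a + 1"
| "com_factor (Seq c d) = com_factor c + com_factor d * (com_growth c)\<^sup>2"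
| "com_factor (Cond b c d) = expr_factor b + 1 + com_factor c + com_factor d"
| "com_factor (While b c) = 0"

lemma fits_mono: "fits B s \<Longrightarrow> B \<le> B' \<Longrightarrow> fits B' s"
  unfolding fits_def using le_trans by blast

lemma fits_run: "loop_free c \<Longrightarrow> fits B (fst \<sigma>) \<Longrightarrow> fits (com_growth c * B) (fst (run c \<sigma>))"
proof (induction c arbitrary: \<sigma> B)
  case (Assign r a)
  then show ?case
    using bits_aval[of B "fst \<sigma>" a] by (auto simp: fits_def trans_le_add1 trans_le_add2)
next
  case (Seq c d)
  then show ?case
    by (simp add: mult.assoc)
next
  case (Cond b c d)
  then have "fits (com_growth c * B) (fst (run c \<sigma>))" "fits (com_growth d * B) (fst (run d \<sigma>))"
    by auto
  then show ?case
    by (auto intro: fits_mono)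
qed auto

lemma acost_Suc_le: "fits B s \<Longrightarrow> acost e s + 1 \<le> (expr_factor e + 1) * B\<^sup>2"
proof -
  assume "fits B s"
  then have "1 \<le> B\<^sup>2" "acost e s \<le> expr_factor e * B\<^sup>2"
    using fits_pos[of B s] acost_le by auto
  then show ?thesis
    by (simp add: distrib_right)
qed

lemma exec_run:
  "loop_free c \<Longrightarrow> fits B (fst \<sigma>) \<Longrightarrow> \<exists>t \<le> com_factor c * B\<^sup>2. exec c \<sigma> t (run c \<sigma>)"
proof (induction c arbitrary: \<sigma> B)
  case Skip
  then show ?case
    using fits_pos[of B "fst \<sigma>"] exec.Skip[of \<sigma>] by (intro exI[of _ 1]) auto
next
  case (Assign r a)
  then show ?case
    using acost_Suc_le[of B "fst \<sigma>" a] exec.Assign[of r a "fst \<sigma>" "snd \<sigma>"]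
    by (intro exI[of _ "acost a (fst \<sigma>) + 1"]) simp
next
  case (Emit a)
  then show ?case
    using acost_Suc_le[of B "fst \<sigma>" a] exec.Emit[of a "fst \<sigma>" "snd \<sigma>"]
    by (intro exI[of _ "acost a (fst \<sigma>) + 1"]) simp
next
  case (Seq c d)
  obtain t where t: "t \<le> com_factor c * B\<^sup>2" "exec c \<sigma> t (run c \<sigma>)"
    using Seq by fastforce
  obtain u where u: "u \<le> com_factor d * (com_growth c * B)\<^sup>2" "exec d (run c \<sigma>) u (run d (run c \<sigma>))"
    using Seq.IH(2) Seq.prems fits_run[of c B \<sigma>] by fastforce
  show ?case
    using t u exec.Seq[OF t(2) u(2)]
    by (intro exI[of _ "t + u"]) (auto simp: distrib_right power_mult_distrib mult.assoc)
next
  case (Cond b c d)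
  have b: "acost b (fst \<sigma>) + 1 \<le> (expr_factor b + 1) * B\<^sup>2"
    using acost_Suc_le Cond.prems(2) by blast
  show ?case
  proof (cases "aval b (fst \<sigma>) > 0")
    case True
    obtain t where "t \<le> com_factor c * B\<^sup>2" "exec c \<sigma> t (run c \<sigma>)"
      using Cond by fastforce
    then show ?thesis
      using True b exec.Cond_true[of b "fst \<sigma>" c "snd \<sigma>" t "run c \<sigma>" d]
      by (intro exI[of _ "acost b (fst \<sigma>) + 1 + t"]) (auto simp: distrib_right)
  next
    case False
    obtain t where "t \<le> com_factor d * B\<^sup>2" "exec d \<sigma> t (run d \<sigma>)"
      using Cond by fastforce
    then show ?thesis
      using False b exec.Cond_false[of b "fst \<sigma>" d "snd \<sigma>" t "run d \<sigma>" c]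
      by (intro exI[of _ "acost b (fst \<sigma>) + 1 + t"]) (auto simp: distrib_right)
  qed
qed auto

text \<open>Iterating \<open>com_growth\<close> would give an exponential bound. The invariant,
  indexed by the number of remaining rounds, instead supplies one bit bound \<open>B\<close> for all
  rounds.\<close>

lemma exec_While:
  assumes "loop_free c"
    and inv: "\<And>j \<sigma>. P j \<sigma> \<Longrightarrow> fits B (fst \<sigma>) \<and> (aval b (fst \<sigma>) > 0 \<longleftrightarrow> j > 0)"
    and step: "\<And>j \<sigma>. P (Suc j) \<sigma> \<Longrightarrow> P j (run c \<sigma>)"
    and "P j \<sigma>"
  shows "\<exists>\<sigma>' t. P 0 \<sigma>' \<and> exec (While b c) \<sigma> t \<sigma>' \<and>
    t \<le> (j + 1) * ((expr_factor b + 1 + com_factor c) * B\<^sup>2)"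
  using \<open>P j \<sigma>\<close>
proof (induction j arbitrary: \<sigma>)
  case 0
  then have "fits B (fst \<sigma>)" "\<not> aval b (fst \<sigma>) > 0"
    using inv by blast+
  then show ?case
    using 0 acost_Suc_le[of B "fst \<sigma>" b] exec.While_false[of b "fst \<sigma>" c "snd \<sigma>"]
    by (intro exI[of _ \<sigma>] exI[of _ "acost b (fst \<sigma>) + 1"]) (auto simp: distrib_right)
next
  case (Suc j)
  then have f: "fits B (fst \<sigma>)" and b: "aval b (fst \<sigma>) > 0"
    using inv by blast+
  obtain t where t: "t \<le> com_factor c * B\<^sup>2" "exec c \<sigma> t (run c \<sigma>)"
    using exec_run[OF assms(1) f] by blast
  obtain \<sigma>' u where u: "u \<le> (j + 1) * ((expr_factor b + 1 + com_factor c) * B\<^sup>2)"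
      "exec (While b c) (run c \<sigma>) u \<sigma>'" and P: "P 0 \<sigma>'"
    using Suc.IH[OF step[OF Suc.prems]] by blast
  have "exec (While b c) \<sigma> (acost b (fst \<sigma>) + 1 + t + u) \<sigma>'"
    using exec.While_true[OF b, of c "snd \<sigma>" t _ u] t(2) u(2) by simp
  moreover have "acost b (fst \<sigma>) + 1 + t \<le> (expr_factor b + 1 + com_factor c) * B\<^sup>2"
    using acost_Suc_le[OF f, of b] t(1) by (simp add: distrib_right)
  then have "acost b (fst \<sigma>) + 1 + t + u \<le> (Suc j + 1) * ((expr_factor b + 1 + com_factor c) * B\<^sup>2)"
    using u(1) by simp
  ultimately show ?case
    using P by blast
qed

section \<open>The algorithm\<close>

text \<open>Registers 0 and 1 hold the target \<open>p / q\<close>, register 4 the number of remaining moves,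
  register 6 the current vertex, register 7 the last vertex in use; 2, 5 and 8 are auxiliary.\<close>

definition vertex_expr :: "nat \<Rightarrow> aexp" where
  "vertex_expr i = (if i = 0 then Reg 6 else Add (Reg 7) (Const (int i)))"

fun emit_edges :: "(nat \<times> nat) list \<Rightarrow> com" where
  "emit_edges [] = Skip"
| "emit_edges ((x, y) # D) = Seq (Emit (vertex_expr x)) (Seq (Emit (vertex_expr y)) (emit_edges D))"

definition edge_code :: "(nat \<times> nat) list \<Rightarrow> int list" where
  "edge_code E = concat (map (\<lambda>(x, y). [int x, int y]) E)"

lemma edge_code_append: "edge_code (E @ E') = edge_code E @ edge_code E'"
  by (simp add: edge_code_def)

lemma loop_free_emit_edges: "loop_free (emit_edges D)"
  by (induction D rule: emit_edges.induct) auto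

lemma run_emit_edges:
  "fst \<sigma> 6 = int c \<Longrightarrow> fst \<sigma> 7 = int b \<Longrightarrow>
    run (emit_edges D) \<sigma> = (fst \<sigma>, snd \<sigma> @ edge_code (emb_edges c b D))"
  by (induction D arbitrary: \<sigma> rule: emit_edges.induct)
    (auto simp: edge_code_def vertex_expr_def emb_def)

definition new_p_expr :: "move \<Rightarrow> aexp" where
  "new_p_expr M = Add (Mul (Const (m11 M)) (Reg 0)) (Mul (Const (m12 M)) (Reg 1))"

definition new_q_expr :: "move \<Rightarrow> aexp" where
  "new_q_expr M = Add (Mul (Const (m21 M)) (Reg 0)) (Mul (Const (m22 M)) (Reg 1))"

lemma aval_new_expr [simp]:
  "aval (new_p_expr M) s = new_p M (s 0) (s 1)" "aval (new_q_expr M) s = new_q M (s 0) (s 1)"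
  by (simp_all add: new_p_expr_def new_q_expr_def new_p_def new_q_def)

text \<open>Edges are written before register 6 moves on. Register 8 holds the new numerator while
  the new denominator is still computed from the old one.\<close>

definition move_com :: "nat \<Rightarrow> move \<Rightarrow> com" where
  "move_com K M = Seq (emit_edges (move_edges K M))
    (Seq (Assign 8 (new_p_expr M)) (Seq (Assign 1 (new_q_expr M)) (Seq (Assign 0 (Reg 8))
      (if linked M then Assign 6 (Add (Reg 7) (Const (int K))) else Skip))))"

lemma loop_free_move_com: "loop_free (move_com K M)"
  by (simp add: move_com_def loop_free_emit_edges)

lemma run_move_com:
  fixes \<sigma> :: config and K :: nat and M :: move
  assumes "fst \<sigma> 6 = int c" "fst \<sigma> 7 = int b"
  defines "\<sigma>' \<equiv> run (move_com K M) \<sigma>"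
  shows "fst \<sigma>' 0 = new_p M (fst \<sigma> 0) (fst \<sigma> 1)" "fst \<sigma>' 1 = new_q M (fst \<sigma> 0) (fst \<sigma> 1)"
    "fst \<sigma>' 8 = new_p M (fst \<sigma> 0) (fst \<sigma> 1)"
    "fst \<sigma>' 6 = int (if linked M then b + K else c)"
    "r \<notin> {0, 1, 6, 8} \<Longrightarrow> fst \<sigma>' r = fst \<sigma> r"
    "snd \<sigma>' = snd \<sigma> @ edge_code (emb_edges c b (move_edges K M))"
  using assms by (auto simp: \<sigma>'_def move_com_def run_emit_edges)

context approximation_scheme
begin

fun pick_com :: "move list \<Rightarrow> com" where
  "pick_com [] = move_com K up"
| "pick_com (M # L) = Cond (Mul (Sub (new_p_expr M) (Mul (Const lo) (new_q_expr M)))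
    (Sub (Mul (Const hi) (new_q_expr M)) (new_p_expr M))) (move_com K M) (pick_com L)"

definition choose_com :: com where
  "choose_com = Cond (Mul (Sub (Reg 0) (Mul (Const hi) (Reg 1))) (Reg 1)) (move_com K up)
    (Cond (Mul (Sub (Mul (Const lo) (Reg 1)) (Reg 0)) (Reg 1)) (move_com K dn) (pick_com Ms))"

definition step_com :: com where
  "step_com = Seq choose_com (Seq (Assign 7 (Add (Reg 7) (Const (int K)))) (Assign 4 (Sub (Reg 4) (Const 1))))"

lemma run_pick_com: "run (pick_com L) \<sigma> = run (move_com K (pick L (fst \<sigma> 0) (fst \<sigma> 1))) \<sigma>"
  by (induction L) auto

lemma run_choose_com: "run choose_com \<sigma> = run (move_com K (choose_move (fst \<sigma> 0) (fst \<sigma> 1))) \<sigma>"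
  by (auto simp: choose_com_def choose_move_def run_pick_com)

lemma loop_free_step_com: "loop_free step_com"
proof -
  have "loop_free (pick_com L)" for L
    by (induction L) (auto simp: loop_free_move_com)
  then show ?thesis
    by (simp add: step_com_def choose_com_def loop_free_move_com)
qed

lemma run_step_com:
  fixes \<sigma> :: config
  assumes "fst \<sigma> 6 = int c" "fst \<sigma> 7 = int b"
  defines "\<sigma>' \<equiv> run step_com \<sigma>" and "M \<equiv> choose_move (fst \<sigma> 0) (fst \<sigma> 1)"
  shows "fst \<sigma>' 0 = new_p M (fst \<sigma> 0) (fst \<sigma> 1)" "fst \<sigma>' 1 = new_q M (fst \<sigma> 0) (fst \<sigma> 1)"
    "fst \<sigma>' 8 = new_p M (fst \<sigma> 0) (fst \<sigma> 1)"
    "fst \<sigma>' 6 = int (if linked M then b + K else c)"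
    "fst \<sigma>' 7 = int (b + K)" "fst \<sigma>' 4 = fst \<sigma> 4 - 1"
    "r \<notin> {0, 1, 4, 6, 7, 8} \<Longrightarrow> fst \<sigma>' r = fst \<sigma> r"
    "snd \<sigma>' = snd \<sigma> @ edge_code (emb_edges c b (move_edges K M))"
  using run_move_com[OF assms(1,2), where K = K and M = M] assms(2)
  by (simp_all add: \<sigma>'_def step_com_def run_choose_com M_def)

lemma new_bounds:
  assumes "M \<in> set (up # dn # Ms)" "\<bar>p\<bar> \<le> 2 ^ l" "\<bar>q\<bar> \<le> 2 ^ l"
  shows "\<bar>new_p M p q\<bar> \<le> 2 ^ (l + \<mu>)" "\<bar>new_q M p q\<bar> \<le> 2 ^ (l + \<mu>)"
proof -
  have lin: "\<bar>a * p + b * q\<bar> \<le> 2 ^ (l + \<mu>)" if "\<bar>a\<bar> + \<bar>b\<bar> \<le> 2 ^ \<mu>" for a b :: int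
  proof -
    have "\<bar>a * p + b * q\<bar> \<le> \<bar>a\<bar> * \<bar>p\<bar> + \<bar>b\<bar> * \<bar>q\<bar>"
      using abs_triangle_ineq[of "a * p" "b * q"] by (simp add: abs_mult)
    also have "\<dots> \<le> \<bar>a\<bar> * 2 ^ l + \<bar>b\<bar> * 2 ^ l"
      using assms by (intro add_mono mult_left_mono) auto
    also have "\<dots> = (\<bar>a\<bar> + \<bar>b\<bar>) * 2 ^ l"
      by (simp add: distrib_right)
    also have "\<dots> \<le> 2 ^ \<mu> * 2 ^ l"
      using that by (intro mult_right_mono) auto
    finally show ?thesis
      by (simp add: power_add mult.commute)
  qed
  show "\<bar>new_p M p q\<bar> \<le> 2 ^ (l + \<mu>)" "\<bar>new_q M p q\<bar> \<le> 2 ^ (l + \<mu>)"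
    using \<mu>[OF assms(1)] by (auto simp: new_p_def new_q_def intro: lin)
qed

section \<open>The program and its three loops\<close>

definition halve_com :: com where
  "halve_com = Seq (Assign 2 (Div (Reg 2) (Const 2))) (Assign 4 (Add (Reg 4) (Const 2)))"

definition size_expr :: aexp where
  "size_expr = Add (Mul (Const (int K)) (Add (Reg 4) (Const 1))) (Const 1)"

definition list_com :: com where
  "list_com = Seq (Emit (Reg 5)) (Assign 5 (Add (Reg 5) (Const 1)))"

text \<open>The bit-length \<open>T\<close> of this single product controls the target and the
  precision: \<open>R\<close> lies between the -T-th and T-th powers of 2, and \<epsilon> is at
  least 1/qe. Two extra moves per halving pay for both: \<open>T\<close> for scaling,
  \<open>T\<close> for contraction.\<close>

definition init_com :: "nat \<Rightarrow> com" where
  "init_com c0 = Seq (Assign 2 (Mul (Mul (Reg 0) (Reg 1)) (Reg 3))) (Assign 4 (Const (int c0)))"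

text \<open>The vertices are listed before the edges are known. Hence every move reserves \<open>K\<close> vertices;
  those it does not need stay isolated, which does not affect the ratio.\<close>

definition program :: "nat \<Rightarrow> com" where
  "program c0 = Seq (init_com c0) (Seq (While (Reg 2) halve_com) (Seq (Emit size_expr)
    (Seq (While (Sub size_expr (Reg 5)) list_com) (Seq (Emit (Const 0))
      (Seq (While (Reg 4) step_com) (emit_edges F))))))"

text \<open>Times the input length plus one, this bounds the bits of all registers and the rounds of
  all loops: the \<mu> term is for numerator and denominator, the \<open>K\<close> term for vertex
  numbers, \<open>c0 + 2\<close> for the number of moves, 3 for the input and small
  constants.\<close>

definition size_factor :: "nat \<Rightarrow> nat" where
  "size_factor c0 = 3 + \<mu> * (c0 + 2) + K * (c0 + 3) + (c0 + 2)"

definition time_factor :: "nat \<Rightarrow> nat" where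
  "time_factor c0 = com_factor (init_com c0) + (expr_factor (Reg 2) + 1 + com_factor halve_com) +
    com_factor (Emit size_expr) + (expr_factor (Sub size_expr (Reg 5)) + 1 + com_factor list_com) +
    com_factor (Emit (Const 0)) + (expr_factor (Reg 4) + 1 + com_factor step_com) +
    com_factor (emit_edges F)"

text \<open>The bit-length of register 2 is the loop counter, since halving drops exactly one binary
  digit.\<close>

lemma exec_halve:
  assumes "fits B (fst \<sigma>)" "fst \<sigma> 2 \<ge> 0" "fst \<sigma> 4 = int c" "c + 2 * nat (bitlen (fst \<sigma> 2)) < B"
  shows "\<exists>\<sigma>' t. exec (While (Reg 2) halve_com) \<sigma> t \<sigma>' \<and>
    t \<le> (nat (bitlen (fst \<sigma> 2)) + 1) * ((expr_factor (Reg 2) + 1 + com_factor halve_com) * B\<^sup>2) \<and>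
    fits B (fst \<sigma>') \<and> fst \<sigma>' 4 = int (c + 2 * nat (bitlen (fst \<sigma> 2))) \<and> snd \<sigma>' = snd \<sigma> \<and>
    (\<forall>r. r \<notin> {2, 4} \<longrightarrow> fst \<sigma>' r = fst \<sigma> r)"
proof -
  define T where "T = nat (bitlen (fst \<sigma> 2))"
  define P where "P j \<sigma>' \<longleftrightarrow> j \<le> T \<and> fst \<sigma>' 2 \<ge> 0 \<and> nat (bitlen (fst \<sigma>' 2)) = j \<and> bits (fst \<sigma>' 2) \<le> B \<and>
    fst \<sigma>' 4 = int (c + 2 * (T - j)) \<and> snd \<sigma>' = snd \<sigma> \<and> (\<forall>r. r \<notin> {2, 4} \<longrightarrow> fst \<sigma>' r = fst \<sigma> r)"
    for j and \<sigma>' :: config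
  have P_fits: "fits B (fst \<sigma>')" if "P j \<sigma>'" for j \<sigma>'
    unfolding fits_def
  proof
    fix r
    have "bits (fst \<sigma>' 4) \<le> B"
      using that assms(4) bits_le_abs[of "fst \<sigma>' 4"] by (auto simp: P_def T_def)
    then show "bits (fst \<sigma>' r) \<le> B"
      using that assms(1) by (cases "r \<in> {2, 4}") (auto simp: P_def fits_def)
  qed
  have "\<exists>\<sigma>' t. P 0 \<sigma>' \<and> exec (While (Reg 2) halve_com) \<sigma> t \<sigma>' \<and>
      t \<le> (T + 1) * ((expr_factor (Reg 2) + 1 + com_factor halve_com) * B\<^sup>2)"
  proof (rule exec_While)
    show "loop_free halve_com"
      by (simp add: halve_com_def)
    show "fits B (fst \<sigma>') \<and> (aval (Reg 2) (fst \<sigma>') > 0 \<longleftrightarrow> j > 0)" if "P j \<sigma>'" for j \<sigma>'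
      using P_fits[OF that] that bitlen_nonneg[of "fst \<sigma>' 2"] bitlen_eq_zero_iff[of "fst \<sigma>' 2"]
      by (auto simp: P_def)
    show "P j (run halve_com \<sigma>')" if "P (Suc j) \<sigma>'" for j \<sigma>'
    proof -
      have "fst \<sigma>' 2 > 0"
        using that bitlen_eq_zero_iff[of "fst \<sigma>' 2"] by (auto simp: P_def)
      then have "nat (bitlen (fst \<sigma>' 2 div 2)) = j"
        using that compute_bitlen[of "fst \<sigma>' 2"] bitlen_nonneg[of "fst \<sigma>' 2 div 2"] by (auto simp: P_def)
      moreover have "bits (fst \<sigma>' 2 div 2) \<le> B"
        using that bits_div[of "fst \<sigma>' 2" 2] by (auto simp: P_def)
      moreover have "T - j = Suc (T - Suc j)"
        using that unfolding P_def by linarith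
      ultimately show ?thesis
        using that by (simp add: P_def halve_com_def)
    qed
    show "P T \<sigma>"
      using assms by (auto simp: P_def T_def fits_def)
  qed
  then obtain \<sigma>' t where t: "P 0 \<sigma>'" "exec (While (Reg 2) halve_com) \<sigma> t \<sigma>'"
      "t \<le> (T + 1) * ((expr_factor (Reg 2) + 1 + com_factor halve_com) * B\<^sup>2)"
    by blast
  show ?thesis
    using t P_fits[OF t(1)] unfolding T_def[symmetric]
    by (intro exI[of _ \<sigma>'] exI[of _ t]) (simp add: P_def)
qed

lemma exec_list:
  assumes "fits B (fst \<sigma>)" "fst \<sigma> 5 = 0" "fst \<sigma> 4 = int n" "K * (n + 1) + 1 < B"
  shows "\<exists>\<sigma>' t. exec (While (Sub size_expr (Reg 5)) list_com) \<sigma> t \<sigma>' \<and>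
    t \<le> (K * (n + 1) + 1 + 1) * ((expr_factor (Sub size_expr (Reg 5)) + 1 + com_factor list_com) * B\<^sup>2) \<and>
    fits B (fst \<sigma>') \<and> snd \<sigma>' = snd \<sigma> @ map int [0..<K * (n + 1) + 1] \<and>
    (\<forall>r. r \<noteq> 5 \<longrightarrow> fst \<sigma>' r = fst \<sigma> r)"
proof -
  define N where "N = K * (n + 1) + 1"
  define P where "P j \<sigma>' \<longleftrightarrow> j \<le> N \<and> fst \<sigma>' 5 = int (N - j) \<and> (\<forall>r. r \<noteq> 5 \<longrightarrow> fst \<sigma>' r = fst \<sigma> r) \<and>
    snd \<sigma>' = snd \<sigma> @ map int [0..<N - j]" for j and \<sigma>' :: config
  have size: "aval size_expr s = int N" if "s 4 = int n" for s
    using that by (simp add: size_expr_def N_def algebra_simps)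
  have P_fits: "fits B (fst \<sigma>')" if "P j \<sigma>'" for j \<sigma>'
    unfolding fits_def
  proof
    fix r
    have "nat \<bar>fst \<sigma>' 5\<bar> \<le> N"
      using that by (simp add: P_def)
    then have "bits (fst \<sigma>' 5) \<le> B"
      using bits_le_abs[of "fst \<sigma>' 5"] assms(4) unfolding N_def by linarith
    then show "bits (fst \<sigma>' r) \<le> B"
      using that assms(1) by (cases "r = 5") (auto simp: P_def fits_def)
  qed
  have "\<exists>\<sigma>' t. P 0 \<sigma>' \<and> exec (While (Sub size_expr (Reg 5)) list_com) \<sigma> t \<sigma>' \<and>
      t \<le> (N + 1) * ((expr_factor (Sub size_expr (Reg 5)) + 1 + com_factor list_com) * B\<^sup>2)"
  proof (rule exec_While)
    show "loop_free list_com"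
      by (simp add: list_com_def)
    show "fits B (fst \<sigma>') \<and> (aval (Sub size_expr (Reg 5)) (fst \<sigma>') > 0 \<longleftrightarrow> j > 0)" if "P j \<sigma>'" for j \<sigma>'
      using P_fits[OF that] that size[of "fst \<sigma>'"] assms(3) by (auto simp: P_def)
    show "P j (run list_com \<sigma>')" if "P (Suc j) \<sigma>'" for j \<sigma>'
    proof -
      have "N - j = Suc (N - Suc j)"
        using that unfolding P_def by linarith
      then show ?thesis
        using that by (simp add: P_def list_com_def)
    qed
    show "P N \<sigma>"
      using assms by (auto simp: P_def)
  qed
  then obtain \<sigma>' t where t: "P 0 \<sigma>'" "exec (While (Sub size_expr (Reg 5)) list_com) \<sigma> t \<sigma>'"
      "t \<le> (N + 1) * ((expr_factor (Sub size_expr (Reg 5)) + 1 + com_factor list_com) * B\<^sup>2)"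
    by blast
  show ?thesis
    using t P_fits[OF t(1)] unfolding N_def[symmetric]
    by (intro exI[of _ \<sigma>'] exI[of _ t]) (simp add: P_def)
qed

text \<open>The invariant says that the output so far, followed by the code of what
  \<open>build\<close> would still produce from the current registers, is constant. Target entries
  gain \<mu> bits per round.\<close>

lemma exec_steps:
  assumes "fits B (fst \<sigma>)" "fst \<sigma> 4 = int n" "fst \<sigma> 6 = 0" "fst \<sigma> 7 = 0" "fst \<sigma> 8 = 0"
    and "\<bar>fst \<sigma> 0\<bar> \<le> 2 ^ l" "\<bar>fst \<sigma> 1\<bar> \<le> 2 ^ l"
    and "K * (n + 1) + 1 < B" "n < B" "l + \<mu> * n + 2 \<le> B"
  shows "\<exists>\<sigma>' t c b. exec (While (Reg 4) step_com) \<sigma> t \<sigma>' \<and>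
    t \<le> (n + 1) * ((expr_factor (Reg 4) + 1 + com_factor step_com) * B\<^sup>2) \<and>
    fits B (fst \<sigma>') \<and> fst \<sigma>' 6 = int c \<and> fst \<sigma>' 7 = int b \<and>
    snd \<sigma>' @ edge_code (emb_edges c b F) = snd \<sigma> @ edge_code (build n (fst \<sigma> 0) (fst \<sigma> 1) 0 0)"
proof -
  define P where "P j \<sigma>' \<longleftrightarrow> j \<le> n \<and> fst \<sigma>' 4 = int j \<and>
    (\<forall>r\<in>{0, 1, 8}. \<bar>fst \<sigma>' r\<bar> \<le> 2 ^ (l + \<mu> * (n - j))) \<and>
    (\<forall>r. r \<notin> {0, 1, 4, 6, 7, 8} \<longrightarrow> fst \<sigma>' r = fst \<sigma> r) \<and>
    (\<exists>c b. fst \<sigma>' 6 = int c \<and> fst \<sigma>' 7 = int b \<and> c \<le> b \<and> b = K * (n - j) \<and>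
      snd \<sigma>' @ edge_code (build j (fst \<sigma>' 0) (fst \<sigma>' 1) c b) =
      snd \<sigma> @ edge_code (build n (fst \<sigma> 0) (fst \<sigma> 1) 0 0))" for j and \<sigma>' :: config
  have P_fits: "fits B (fst \<sigma>')" if P: "P j \<sigma>'" for j \<sigma>'
    unfolding fits_def
  proof
    fix r
    obtain c b where cb: "fst \<sigma>' 6 = int c" "fst \<sigma>' 7 = int b" "c \<le> b" "b = K * (n - j)"
      using P unfolding P_def by blast
    have "b \<le> K * (n + 1)"
      unfolding cb by (intro mult_left_mono) auto
    then have "bits (fst \<sigma>' r) \<le> B" if "r \<in> {6, 7}"
      using that cb(1-3) bits_le_abs[of "fst \<sigma>' r"] assms(8) by auto
    moreover have "bits (fst \<sigma>' r) \<le> B" if "r = 4"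
      using that P bits_le_abs[of "fst \<sigma>' r"] assms(9) by (auto simp: P_def)
    moreover have "bits (fst \<sigma>' r) \<le> B" if "r \<in> {0, 1, 8}"
    proof -
      have "\<bar>fst \<sigma>' r\<bar> \<le> 2 ^ (l + \<mu> * (n - j))"
        using P that by (auto simp: P_def)
      also have "\<dots> < 2 ^ (l + \<mu> * n + 1)"
        by (intro power_strict_increasing) (auto simp: le_imp_less_Suc)
      finally have "bits (fst \<sigma>' r) \<le> Suc (l + \<mu> * n + 1)"
        by (simp only: bits_le_iff)
      then show ?thesis
        using assms(10) by simp
    qed
    moreover have "bits (fst \<sigma>' r) \<le> B" if "r \<notin> {0, 1, 4, 6, 7, 8}"
      using P that assms(1) unfolding P_def fits_def by metis
    ultimately show "bits (fst \<sigma>' r) \<le> B"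
      by blast
  qed
  have "\<exists>\<sigma>' t. P 0 \<sigma>' \<and> exec (While (Reg 4) step_com) \<sigma> t \<sigma>' \<and>
      t \<le> (n + 1) * ((expr_factor (Reg 4) + 1 + com_factor step_com) * B\<^sup>2)"
  proof (rule exec_While)
    show "loop_free step_com"
      by (rule loop_free_step_com)
    show "fits B (fst \<sigma>') \<and> (aval (Reg 4) (fst \<sigma>') > 0 \<longleftrightarrow> j > 0)" if "P j \<sigma>'" for j \<sigma>'
      using P_fits[OF that] that by (auto simp: P_def)
    show "P j (run step_com \<sigma>')" if P: "P (Suc j) \<sigma>'" for j \<sigma>'
    proof -
      obtain c b where cb: "fst \<sigma>' 6 = int c" "fst \<sigma>' 7 = int b" "c \<le> b" "b = K * (n - Suc j)"
          "snd \<sigma>' @ edge_code (build (Suc j) (fst \<sigma>' 0) (fst \<sigma>' 1) c b) =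
            snd \<sigma> @ edge_code (build n (fst \<sigma> 0) (fst \<sigma> 1) 0 0)"
        using P unfolding P_def by blast
      define M where "M = choose_move (fst \<sigma>' 0) (fst \<sigma>' 1)"
      note step = run_step_com[OF cb(1,2), folded M_def]
      have nj: "n - j = Suc (n - Suc j)" "Suc j \<le> n"
        using P unfolding P_def by linarith+
      have e: "l + \<mu> * (n - Suc j) + \<mu> = l + \<mu> * (n - j)"
        by (simp add: nj)
      have "M \<in> set (up # dn # Ms)"
        unfolding M_def by (rule choose_move_in)
      then have bd: "\<bar>new_p M (fst \<sigma>' 0) (fst \<sigma>' 1)\<bar> \<le> 2 ^ (l + \<mu> * (n - j))"
          "\<bar>new_q M (fst \<sigma>' 0) (fst \<sigma>' 1)\<bar> \<le> 2 ^ (l + \<mu> * (n - j))"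
        using new_bounds[of M "fst \<sigma>' 0" "l + \<mu> * (n - Suc j)" "fst \<sigma>' 1"] P unfolding e
        by (auto simp: P_def)
      have out: "snd \<sigma>' @ edge_code (emb_edges c b (move_edges K M)) @
          edge_code (build j (new_p M (fst \<sigma>' 0) (fst \<sigma>' 1)) (new_q M (fst \<sigma>' 0) (fst \<sigma>' 1))
            (if linked M then b + K else c) (b + K)) =
          snd \<sigma> @ edge_code (build n (fst \<sigma> 0) (fst \<sigma> 1) 0 0)"
        using cb(5) unfolding build.simps M_def[symmetric] edge_code_append .
      have "\<exists>c b. fst (run step_com \<sigma>') 6 = int c \<and> fst (run step_com \<sigma>') 7 = int b \<and> c \<le> b \<and>
        b = K * (n - j) \<and> snd (run step_com \<sigma>') @
          edge_code (build j (fst (run step_com \<sigma>') 0) (fst (run step_com \<sigma>') 1) c b) =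
        snd \<sigma> @ edge_code (build n (fst \<sigma> 0) (fst \<sigma> 1) 0 0)"
        unfolding step(1,2,4,5,8) using cb(3,4) out nj
        by - (rule exI[of _ "if linked M then b + K else c"], rule exI[of _ "b + K"], simp)
      moreover have "fst (run step_com \<sigma>') r = fst \<sigma> r" if "r \<notin> {0, 1, 4, 6, 7, 8}" for r
        using step(7)[OF that] P that unfolding P_def by simp
      moreover have "\<forall>r\<in>{0, 1, 8}. \<bar>fst (run step_com \<sigma>') r\<bar> \<le> 2 ^ (l + \<mu> * (n - j))"
        using bd step(1,2,3) by auto
      moreover have "fst (run step_com \<sigma>') 4 = int j" "j \<le> n"
        using P nj(2) step(6) by (auto simp: P_def)
      ultimately show ?thesis
        unfolding P_def by blast
    qed
    show "P n \<sigma>"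
      using assms by (auto simp: P_def)
  qed
  then obtain \<sigma>' t where t: "P 0 \<sigma>'" "exec (While (Reg 4) step_com) \<sigma> t \<sigma>'"
      "t \<le> (n + 1) * ((expr_factor (Reg 4) + 1 + com_factor step_com) * B\<^sup>2)"
    by blast
  then obtain c b where "fst \<sigma>' 6 = int c" "fst \<sigma>' 7 = int b"
      "snd \<sigma>' @ edge_code (emb_edges c b F) = snd \<sigma> @ edge_code (build n (fst \<sigma> 0) (fst \<sigma> 1) 0 0)"
    unfolding P_def build.simps by blast
  then show ?thesis
    using t(2,3) P_fits[OF t(1)] by blast
qed

end

text \<open>With \<open>B\<close> linear in the input length, each loop makes at most
  \<open>B\<close> rounds of quadratic cost, hence the cube.\<close>

lemma (in approximation_scheme) exec_program:
  fixes pr qr pe qe :: int and c0 :: nat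
  assumes pos: "pr > 0" "qr > 0" "qe > 0"
  defines "len \<equiv> bit_length [pr, qr, pe, qe]"
    and "n \<equiv> c0 + 2 * nat (bitlen (pr * qr * qe))"
  shows "\<exists>t s. exec (program c0) (init_regs [pr, qr, pe, qe], []) t
      (s, int (K * (n + 1) + 1) # map int [0..<K * (n + 1) + 1] @ 0 # edge_code (build n pr qr 0 0)) \<and>
    t \<le> time_factor c0 * size_factor c0 ^ 3 * (1 + len) ^ 3"
proof -
  define T where "T = nat (bitlen (pr * qr * qe))"
  define N where "N = K * (n + 1) + 1"
  define L where "L = 1 + len"
  define B where "B = size_factor c0 * L"
  have len: "len = bits pr + bits qr + bits pe + bits qe"
    by (simp add: len_def bit_length_def)
  have prod_bits: "bits (pr * qr * qe) \<le> len"
    using bits_mult[of "pr * qr" qe] bits_mult[of pr qr] by (simp add: len)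
  have "bits (pr * qr * qe) = T + 1"
    using pos by (simp add: bits_def T_def)
  then have T: "T \<le> L"
    using prod_bits by (simp add: L_def)
  have n: "n = c0 + 2 * T"
    by (simp add: n_def T_def)
  have "c0 \<le> c0 * L"
    by (simp add: L_def)
  then have nL: "n \<le> (c0 + 2) * L"
    using T unfolding n distrib_right by linarith
  have B: "B = 3 * L + \<mu> * ((c0 + 2) * L) + K * ((c0 + 3) * L) + (c0 + 2) * L"
    by (simp add: B_def size_factor_def algebra_simps)
  have "\<mu> * n \<le> \<mu> * ((c0 + 2) * L)"
    using nL by (rule mult_left_mono) simp
  then have B1: "len + \<mu> * n + 2 \<le> B"
    by (simp add: B L_def)
  have "(c0 + 3) * L = (c0 + 2) * L + L" "1 \<le> L"
    by (simp_all add: L_def algebra_simps)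
  then have "n + 1 \<le> (c0 + 3) * L"
    using nL by linarith
  then have "K * (n + 1) \<le> K * ((c0 + 3) * L)"
    by (rule mult_left_mono) simp
  then have NB: "N < B"
    by (simp add: B N_def L_def)
  have nB: "n < B"
    using nL by (simp add: B L_def)
  have TB: "T < B"
    using T by (simp add: B L_def)
  have lenB: "len \<le> B" "1 \<le> B"
    by (auto simp: B L_def)

  let ?\<sigma>0 = "(init_regs [pr, qr, pe, qe], []) :: config"
  have init: "init_regs [pr, qr, pe, qe] r = (if r = 0 then pr else if r = 1 then qr else if r = 2 then pe
      else if r = 3 then qe else 0)" for r
    by (auto simp: init_regs_def nth_Cons' numeral_eq_Suc)
  have "bits 0 = 1"
    by (simp add: bits_def)
  then have f0: "fits B (fst ?\<sigma>0)"
    using lenB unfolding fits_def fst_conv init by (auto simp: len)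
  define \<sigma>1 where "\<sigma>1 = run (init_com c0) ?\<sigma>0"
  have \<sigma>1: "\<sigma>1 = ((fst ?\<sigma>0)(2 := pr * qr * qe, 4 := int c0), [])"
    by (simp add: \<sigma>1_def init_com_def init)
  obtain t1 where t1: "t1 \<le> com_factor (init_com c0) * B\<^sup>2" "exec (init_com c0) ?\<sigma>0 t1 \<sigma>1"
    using exec_run[of "init_com c0" B ?\<sigma>0] f0 unfolding \<sigma>1_def by (auto simp: init_com_def)
  have "bits (int c0) \<le> B"
    using bits_le_abs[of "int c0"] nB n by simp
  then have f1: "fits B (fst \<sigma>1)"
    using f0 prod_bits lenB by (simp add: \<sigma>1 fits_def)
  have 1: "fst \<sigma>1 2 = pr * qr * qe" "fst \<sigma>1 4 = int c0" "snd \<sigma>1 = []"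
    "fst \<sigma>1 0 = pr" "fst \<sigma>1 1 = qr" "fst \<sigma>1 5 = 0" "fst \<sigma>1 6 = 0" "fst \<sigma>1 7 = 0" "fst \<sigma>1 8 = 0"
    by (simp_all add: \<sigma>1 init)

  obtain \<sigma>2 t2 where t2: "exec (While (Reg 2) halve_com) \<sigma>1 t2 \<sigma>2"
      "t2 \<le> (T + 1) * ((expr_factor (Reg 2) + 1 + com_factor halve_com) * B\<^sup>2)"
    and 2: "fits B (fst \<sigma>2)" "fst \<sigma>2 4 = int n" "snd \<sigma>2 = []" "\<And>r. r \<notin> {2, 4} \<Longrightarrow> fst \<sigma>2 r = fst \<sigma>1 r"
    using exec_halve[OF f1, of c0] 1 pos nB n unfolding T_def[symmetric] 1 by auto

  define \<sigma>3 where "\<sigma>3 = run (Emit size_expr) \<sigma>2"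
  obtain t3 where t3: "t3 \<le> com_factor (Emit size_expr) * B\<^sup>2" "exec (Emit size_expr) \<sigma>2 t3 \<sigma>3"
    using exec_run[of "Emit size_expr" B \<sigma>2] 2(1) unfolding \<sigma>3_def by auto
  have 3: "fst \<sigma>3 = fst \<sigma>2" "snd \<sigma>3 = [int N]"
    using 2(2,3) by (auto simp: \<sigma>3_def size_expr_def N_def algebra_simps)

  obtain \<sigma>4 t4 where t4: "exec (While (Sub size_expr (Reg 5)) list_com) \<sigma>3 t4 \<sigma>4"
      "t4 \<le> (N + 1) * ((expr_factor (Sub size_expr (Reg 5)) + 1 + com_factor list_com) * B\<^sup>2)"
    and 4: "fits B (fst \<sigma>4)" "snd \<sigma>4 = int N # map int [0..<N]" "\<And>r. r \<noteq> 5 \<Longrightarrow> fst \<sigma>4 r = fst \<sigma>2 r"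
    using exec_list[of B \<sigma>3 n] 2 1(6) NB unfolding 3 N_def[symmetric] by auto

  define \<sigma>5 where "\<sigma>5 = run (Emit (Const 0)) \<sigma>4"
  obtain t5 where t5: "t5 \<le> com_factor (Emit (Const 0)) * B\<^sup>2" "exec (Emit (Const 0)) \<sigma>4 t5 \<sigma>5"
    using exec_run[of "Emit (Const 0)" B \<sigma>4] 4(1) unfolding \<sigma>5_def by auto
  have 5: "fst \<sigma>5 = fst \<sigma>4" "snd \<sigma>5 = int N # map int [0..<N] @ [0]"
    using 4(2) by (auto simp: \<sigma>5_def)
  have regs: "fst \<sigma>4 0 = pr" "fst \<sigma>4 1 = qr" "fst \<sigma>4 4 = int n" "fst \<sigma>4 6 = 0" "fst \<sigma>4 7 = 0" "fst \<sigma>4 8 = 0"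
    using 4(3) 2(2,4) 1 by simp_all
  have small: "\<bar>x\<bar> \<le> 2 ^ len" if "bits x \<le> len" for x
  proof -
    have "\<bar>x\<bar> < 2 ^ (bits x - 1)"
      by (rule abs_less_two_power_bits)
    also have "\<dots> \<le> 2 ^ len"
      using that by (intro power_increasing) auto
    finally show ?thesis
      by simp
  qed

  obtain \<sigma>6 t6 c b where t6: "exec (While (Reg 4) step_com) \<sigma>5 t6 \<sigma>6"
      "t6 \<le> (n + 1) * ((expr_factor (Reg 4) + 1 + com_factor step_com) * B\<^sup>2)"
    and 6: "fits B (fst \<sigma>6)" "fst \<sigma>6 6 = int c" "fst \<sigma>6 7 = int b"
      "snd \<sigma>6 @ edge_code (emb_edges c b F) = snd \<sigma>5 @ edge_code (build n pr qr 0 0)"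
    using exec_steps[of B \<sigma>5 n len] 4(1) regs NB nB B1 small[of pr] small[of qr] len
    unfolding 5 N_def by auto

  obtain t7 where t7: "t7 \<le> com_factor (emit_edges F) * B\<^sup>2"
      "exec (emit_edges F) \<sigma>6 t7 (fst \<sigma>6, int N # map int [0..<N] @ 0 # edge_code (build n pr qr 0 0))"
    using exec_run[OF loop_free_emit_edges 6(1), of F] run_emit_edges[OF 6(2,3), of F] 6(4) 5(2) by auto

  have "exec (program c0) ?\<sigma>0 (t1 + (t2 + (t3 + (t4 + (t5 + (t6 + t7))))))
      (fst \<sigma>6, int N # map int [0..<N] @ 0 # edge_code (build n pr qr 0 0))"
    unfolding program_def
    by (rule exec.Seq[OF t1(2) exec.Seq[OF t2(1) exec.Seq[OF t3(2) exec.Seq[OF t4(1)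
          exec.Seq[OF t5(2) exec.Seq[OF t6(1) t7(2)]]]]]])
  moreover have "t1 + (t2 + (t3 + (t4 + (t5 + (t6 + t7))))) \<le> time_factor c0 * B ^ 3"
  proof -
    have sq: "x * B\<^sup>2 \<le> x * B ^ 3" for x
      using lenB by (intro mult_left_mono power_increasing) auto
    have cube: "i * (x * B\<^sup>2) \<le> x * B ^ 3" if "i \<le> B" for i x
    proof -
      have "i * (x * B\<^sup>2) \<le> B * (x * B\<^sup>2)"
        using that by (rule mult_right_mono) simp
      then show ?thesis
        by (simp add: power2_eq_square power3_eq_cube ac_simps)
    qed
    have "T + 1 \<le> B" "N + 1 \<le> B" "n + 1 \<le> B"
      using TB NB nB by simp_all
    then have "t1 + (t2 + (t3 + (t4 + (t5 + (t6 + t7))))) \<le> com_factor (init_com c0) * B ^ 3 +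
      ((expr_factor (Reg 2) + 1 + com_factor halve_com) * B ^ 3 + (com_factor (Emit size_expr) * B ^ 3 +
      ((expr_factor (Sub size_expr (Reg 5)) + 1 + com_factor list_com) * B ^ 3 +
      (com_factor (Emit (Const 0)) * B ^ 3 + ((expr_factor (Reg 4) + 1 + com_factor step_com) * B ^ 3 +
      com_factor (emit_edges F) * B ^ 3)))))"
      by (intro add_mono le_trans[OF t1(1) sq] le_trans[OF t2(2) cube] le_trans[OF t3(1) sq]
          le_trans[OF t4(2) cube] le_trans[OF t5(1) sq] le_trans[OF t6(2) cube] le_trans[OF t7(1) sq])
    also have "\<dots> = time_factor c0 * B ^ 3"
      by (simp only: time_factor_def distrib_right add.assoc)
    finally show ?thesis .
  qed
  ultimately show ?thesis
    unfolding N_def[symmetric] B_def L_def power_mult_distrib mult.assoc by blast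
qed

theorem theorem7:
  fixes \<beta> \<gamma> :: real
  assumes "\<beta> \<in> \<rat>" and "\<gamma> \<in> \<rat>" and "(\<beta>, \<gamma>) \<in> param_region"
  shows "\<exists>(c :: com) (p :: nat poly). \<forall>(R :: rat) (\<epsilon> :: rat). R > 0 \<longrightarrow> \<epsilon> > 0 \<longrightarrow>
    (\<exists>t out G v.
       computes_in_time c (encode_rat R @ encode_rat \<epsilon>) t out
       \<and> t \<le> poly p (bit_length (encode_rat R @ encode_rat \<epsilon>))
       \<and> encodes_graph out G v
       \<and> wf_multigraph G \<and> v \<in> verts G
       \<and> Z \<beta> \<gamma> G v 0 \<noteq> 0
       \<and> Z \<beta> \<gamma> G v 1 / Z \<beta> \<gamma> G v 0
           \<in> {exp (- of_rat \<epsilon>) * of_rat R <..< exp (of_rat \<epsilon>) * of_rat R})"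
proof -
  interpret spin_region \<beta> \<gamma>
    by unfold_locales (rule assms(3))
  obtain K lo hi up dn Ms F \<mu> where "approximation_scheme \<beta> \<gamma> K lo hi up dn Ms F \<mu>"
    using approximation_scheme_exists[OF assms(1,2)] by blast
  then interpret approximation_scheme \<beta> \<gamma> K lo hi up dn Ms F \<mu> .
  \<comment> \<open>\<open>c1\<close> absorbs the initial logarithmic error, \<open>c2\<close> the
    lower end of the window; both depend on \<beta> and \<gamma> only.\<close>
  obtain c1 where c1: "ln (real_of_int hi / of_int lo) < 2 ^ c1"
    using real_arch_pow[of 2 "ln (real_of_int hi / of_int lo)"] by fastforce
  obtain c2 where c2: "real_of_int lo < 2 ^ c2"
    using real_arch_pow[of 2 "real_of_int lo"] by fastforce
  define c0 where "c0 = c1 + c2 + 1"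
  define p :: "nat poly" where "p = smult (time_factor c0 * size_factor c0 ^ 3) ([:1, 1:] ^ 3)"
  show ?thesis
  proof (rule exI[of _ "program c0"], rule exI[of _ p], intro allI impI)
    fix R \<epsilon> :: rat
    assume R: "R > 0" and \<epsilon>: "\<epsilon> > 0"
    obtain pr qr where r: "quotient_of R = (pr, qr)"
      by fastforce
    obtain pe qe where e: "quotient_of \<epsilon> = (pe, qe)"
      by fastforce
    have q: "qr > 0" "qe > 0"
      using r e quotient_of_denom_pos by blast+
    have Rr: "(of_rat R :: real) = of_int pr / of_int qr" and er: "(of_rat \<epsilon> :: real) = of_int pe / of_int qe"
      using quotient_of_div[OF r] quotient_of_div[OF e] by (simp_all add: of_rat_divide)
    have R0: "(of_rat R :: real) > 0" and \<epsilon>0: "(of_rat \<epsilon> :: real) > 0"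
      using R \<epsilon> by simp_all
    have p: "pr > 0" "pe > 0"
      using R0 \<epsilon>0 q unfolding Rr er by (simp_all add: zero_less_divide_iff)
    have code: "encode_rat R @ encode_rat \<epsilon> = [pr, qr, pe, qe]"
      by (simp add: encode_rat_def r e)
    define T where "T = nat (bitlen (pr * qr * qe))"
    define n where "n = c0 + 2 * T"
    define N where "N = K * (n + 1) + 1"
    define out where "out = int N # map int [0..<N] @ 0 # edge_code (build n pr qr 0 0)"
    obtain t s where t: "exec (program c0) (init_regs [pr, qr, pe, qe], []) t (s, out)"
        "t \<le> time_factor c0 * size_factor c0 ^ 3 * (1 + bit_length [pr, qr, pe, qe]) ^ 3"
      using exec_program[OF p(1) q, of c0 pe] unfolding out_def N_def n_def T_def by blast

    have prod: "pr * qr * qe < 2 ^ T"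
      using bitlen_bounds[of "pr * qr * qe"] p q by (simp add: T_def)
    \<comment> \<open>All three factors are positive integers, so the bound on the product passes to
      each of them.\<close>
    have "pr \<le> pr * qr * qe" "qr \<le> pr * qr * qe" "qe \<le> pr * qr * qe"
      using p q by (simp_all add: mult_le_cancel_left1 mult_le_cancel_right1 int_one_le_iff_zero_less)
    then have "pr < 2 ^ T" "qr < 2 ^ T" "qe < 2 ^ T"
      using prod by linarith+
    then have lt: "real_of_int pr < 2 ^ T" "real_of_int qr < 2 ^ T" "real_of_int qe < 2 ^ T"
      by (metis of_int_less_iff of_int_numeral of_int_power)+
    have "real_of_int lo / 2 ^ (T + c2) \<le> 2 ^ c2 / 2 ^ (T + c2)"
      using c2 by (intro divide_right_mono) auto
    also have "\<dots> = 1 / 2 ^ T"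
      by (simp add: power_add)
    also have "\<dots> \<le> 1 / of_int qr"
      using lt q by (intro divide_left_mono) auto
    also have "\<dots> \<le> of_int pr / of_int qr"
      using p q by (intro divide_right_mono) auto
    finally have lower: "real_of_int lo / 2 ^ (T + c2) \<le> of_int pr / of_int qr" .
    have "real_of_int pr / of_int qr \<le> of_int pr / 1"
      using p q by (intro divide_left_mono) auto
    also have "\<dots> \<le> 1 * 2 ^ T"
      using lt by simp
    also have "\<dots> \<le> of_int hi * 2 ^ (T + c2)"
      using lo lo_hi by (intro mult_mono power_increasing) auto
    finally have upper: "real_of_int pr / of_int qr \<le> of_int hi * 2 ^ (T + c2)" .
    have "qr \<noteq> 0" "T + c2 \<le> n"
      using q by (auto simp: n_def c0_def)
    from build_correct[OF this(1) le_refl[of 0] this(2) lower upper]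
    obtain z0 z1 where z: "rooted (insert 0 {0<..0 + K * (n + 1)}) (build n pr qr 0 0) 0 z0 z1"
        "z0 \<noteq> 0" "z1 / z0 > 0" "\<bar>ln (z1 / z0) - ln (of_rat R)\<bar> \<le> ln (of_int hi / of_int lo) / 2 ^ (n - (T + c2))"
      unfolding Rr by blast
    \<comment> \<open>At most \<open>T + c2\<close> moves are reserved for scaling; the remaining
      ones bring the error below the -T-th power of 2, hence below 1/qe.\<close>
    have "n - (T + c2) = T + 1 + c1"
      by (simp add: n_def c0_def)
    then have "ln (real_of_int hi / of_int lo) / 2 ^ (n - (T + c2)) \<le> 2 ^ c1 / 2 ^ (T + 1 + c1)"
      using c1 by (simp add: divide_right_mono)
    also have "\<dots> = 1 / 2 ^ (T + 1)"
      by (simp add: power_add)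
    also have "\<dots> \<le> 1 / 2 ^ T"
      by (intro divide_left_mono power_increasing) auto
    also have "\<dots> < 1 / of_int qe"
      using lt q by (intro divide_strict_left_mono) auto
    also have "\<dots> \<le> of_rat \<epsilon>"
      unfolding er using p q by (intro divide_right_mono) auto
    finally have err: "\<bar>ln (z1 / z0) - ln (of_rat R)\<bar> < of_rat \<epsilon>"
      using z(4) by linarith
    have "exp (- of_rat \<epsilon>) * of_rat R = exp (ln (of_rat R) - (of_rat \<epsilon> :: real))"
      "exp (of_rat \<epsilon>) * of_rat R = exp (ln (of_rat R) + (of_rat \<epsilon> :: real))"
      using R0 by (simp_all add: exp_add exp_diff exp_minus field_simps)
    moreover have "z1 / z0 = exp (ln (z1 / z0))"
      using z(3) by simp
    ultimately have ratio: "z1 / z0 \<in> {exp (- of_rat \<epsilon>) * of_rat R <..< exp (of_rat \<epsilon>) * of_rat R}"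
      using err by (metis abs_diff_less_iff exp_less_mono greaterThanLessThan_iff)

    define G where "G = mgraph {..<N} (build n pr qr 0 0)"
    have "insert 0 {0<..0 + K * (n + 1)} = {..<N}"
      by (auto simp: N_def)
    with z(1) have rooted: "rooted {..<N} (build n pr qr 0 0) 0 z0 z1"
      by simp
    show "\<exists>t out G v. computes_in_time (program c0) (encode_rat R @ encode_rat \<epsilon>) t out
       \<and> t \<le> poly p (bit_length (encode_rat R @ encode_rat \<epsilon>))
       \<and> encodes_graph out G v
       \<and> wf_multigraph G \<and> v \<in> verts G
       \<and> Z \<beta> \<gamma> G v 0 \<noteq> 0
       \<and> Z \<beta> \<gamma> G v 1 / Z \<beta> \<gamma> G v 0
           \<in> {exp (- of_rat \<epsilon>) * of_rat R <..< exp (of_rat \<epsilon>) * of_rat R}"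
    proof (rule exI[of _ t], rule exI[of _ out], rule exI[of _ G], rule exI[of _ 0], intro conjI)
      show "computes_in_time (program c0) (encode_rat R @ encode_rat \<epsilon>) t out"
        using t(1) unfolding code computes_in_time_def by blast
      show "t \<le> poly p (bit_length (encode_rat R @ encode_rat \<epsilon>))"
        using t(2) unfolding code p_def by (simp add: poly_power)
      show "encodes_graph out G 0"
        unfolding encodes_graph_def
        by (rule exI[of _ "[0..<N]"], rule exI[of _ "build n pr qr 0 0"])
          (auto simp: G_def mgraph_def out_def edge_code_def)
      show "wf_multigraph G"
        using rooted unfolding G_def by (intro wf_mgraph) (auto simp: rooted_def)
      show "0 \<in> verts G"
        by (simp add: G_def mgraph_def N_def)
      show "Z \<beta> \<gamma> G 0 0 \<noteq> 0"
        using rooted z(2) by (simp add: G_def rooted_def)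
      show "Z \<beta> \<gamma> G 0 1 / Z \<beta> \<gamma> G 0 0 \<in> {exp (- of_rat \<epsilon>) * of_rat R <..< exp (of_rat \<epsilon>) * of_rat R}"
        using rooted ratio unfolding G_def rooted_def by blast
    qed
  qed
qed

end
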